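(* Let $d\ge2$, $J>0$, and let $X$ be the Ising model on $\mathbb{Z}^d$ with coupling constant $J$ (identifying $-1$ with $0$). If $$\frac{e^{2dJ}}{e^{2dJ}+e^{-2dJ}}\le\frac{1}{1-r_2^{(2d)}},$$ then $X\notin\mathcal{R}$.
   Context: Let $S$ be a finite or countably infinite set, and identify the power set $\mathcal{P}(S)$ with $\{0,1\}^S$ (product topology, Borel $\sigma$-algebra). For a $\sigma$-finite measure $\nu$ on $\mathcal{P}(S)\setminus\{\emptyset\}$, let $Y^\nu=\{B_j\}_{j\in I}$ be the Poisson process on $\mathcal{P}(S)\setminus\{\emptyset\}$ with intensity measure $\nu$. Define $X^\nu=(X^\nu_i)_{i\in S}$ by $X^\nu_i=1$ if $i\in\bigcup_{j\in I}B_j$ and $X^\nu_i=0$ otherwise. $\mathcal{R}$ denotes the set of all $\{0,1\}$-valued processes $(X_i)_{i\in S}$ that are equal in distribution to $X^\nu$ for some $\nu$. Here $S=\mathbb{Z}^d$. The Ising model on $\mathbb{Z}^d$ with coupling constant $J$ means an infinite-volume Gibbs measure on $\{-1,1\}^{\mathbb{Z}^d}$ for the nearest-neighbour ferromagnetic interaction without external field, i.e. finite-volume conditional distributions have weights proportional to $\exp\bigl(J\sum_{i\sim j}\sigma_i\sigma_j\bigr)$, the sum being over nearest-neighbour pairs. For integers $k\ge2$, the polylogarithm $\operatorname{Li}_{1-k}$ is the rational function $\operatorname{Li}_{1-k}(z)=\bigl(z\frac{d}{dz}\bigr)^{k-1}\frac{z}{1-z}$ (the continuation of $\sum_{j\ge1}j^{k-1}z^j$).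 For $n\ge3$, $r_2^{(n)}\in(-\infty,0)$ denotes the largest strictly negative real root of $\operatorname{Li}_{1-n}$. *)

theory Defs
  imports "HOL-Probability.Probability"
begin

section \<open>Poisson processes and the class R\<close>

(* A random collection of points {B_j : j in I} is given by a random index set I w, a set of
   naturals (intensities are sigma-finite, so countably many indices suffice), and random points
   B w j; repeated points are counted with multiplicity. *)
definition point_count :: "nat set \<Rightarrow> (nat \<Rightarrow> 'a) \<Rightarrow> 'a set \<Rightarrow> ennreal" where
  "point_count I B A = emeasure (count_space UNIV) {j \<in> I. B j \<in> A}"

definition poisson_process ::
  "'w measure \<Rightarrow> 'a measure \<Rightarrow> ('w \<Rightarrow> nat set) \<Rightarrow> ('w \<Rightarrow> nat \<Rightarrow> 'a) \<Rightarrow> bool" where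
  "poisson_process P \<nu> I B \<longleftrightarrow>
     prob_space P \<and>
     (\<forall>\<omega>\<in>space P. \<forall>j\<in>I \<omega>. B \<omega> j \<in> space \<nu>) \<and>
     (\<forall>A\<in>sets \<nu>. (\<lambda>\<omega>. point_count (I \<omega>) (B \<omega>) A) \<in> borel_measurable P) \<and>
     (\<forall>A\<in>sets \<nu>. emeasure \<nu> A < \<infinity> \<longrightarrow>
        (\<forall>n. measure P {\<omega>\<in>space P. point_count (I \<omega>) (B \<omega>) A = of_nat n}
             = exp (- measure \<nu> A) * measure \<nu> A ^ n / fact n)) \<and>
     (\<forall>A\<in>sets \<nu>. emeasure \<nu> A = \<infinity> \<longrightarrow>
        (AE \<omega> in P. point_count (I \<omega>) (B \<omega>) A = \<infinity>)) \<and>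
     (\<forall>(n::nat) A. (\<forall>i<n. A i \<in> sets \<nu>) \<longrightarrow> disjoint_family_on A {..<n} \<longrightarrow>
        prob_space.indep_vars P (\<lambda>_. borel)
          (\<lambda>i \<omega>. point_count (I \<omega>) (B \<omega>) (A i)) {..<n})"

(* Subsets of S are represented by their indicators S => bool; the type class topology on this
   function type is the product topology. *)
definition nonempty_subsets :: "('s::countable \<Rightarrow> bool) measure" where
  "nonempty_subsets = restrict_space borel {b. b \<noteq> (\<lambda>_. False)}"

definition union_process ::
  "('w \<Rightarrow> nat set) \<Rightarrow> ('w \<Rightarrow> nat \<Rightarrow> 's \<Rightarrow> bool) \<Rightarrow> 'w \<Rightarrow> 's \<Rightarrow> bool" where
  "union_process I B \<omega> i \<longleftrightarrow> (\<exists>j\<in>I \<omega>. B \<omega> j i)"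

(* The value True stands for 1. The Poisson process may live on any probability space; it is
   carried here by the type of pairs (index set, points). Since poisson_process only depends on
   the joint behaviour of (I, B), a Poisson process on another space can be pushed forward to this
   type, so nothing is lost. *)
definition in_R :: "'w measure \<Rightarrow> ('w \<Rightarrow> 's::countable \<Rightarrow> bool) \<Rightarrow> bool" where
  "in_R M X \<longleftrightarrow>
     prob_space M \<and> X \<in> borel_measurable M \<and>
     (\<exists>\<nu> (P :: (nat set \<times> (nat \<Rightarrow> 's \<Rightarrow> bool)) measure) I B.
        sigma_finite_measure \<nu> \<and> sets \<nu> = sets nonempty_subsets \<and>
        poisson_process P \<nu> I B \<and>
        distr M borel X = distr P borel (union_process I B))"

section \<open>The Ising model\<close>

definition neighbours :: "int ^ 'd \<Rightarrow> int ^ 'd::finite \<Rightarrow> bool" where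
  "neighbours i j \<longleftrightarrow> (\<Sum>k\<in>UNIV. \<bar>i $ k - j $ k\<bar>) = 1"

definition nn_pairs :: "(int ^ 'd::finite) set set" where
  "nn_pairs = {{i, j} | i j. neighbours i j}"

definition spins :: "'s set \<Rightarrow> ('s \<Rightarrow> int) measure" where
  "spins \<Lambda> = Pi\<^sub>M \<Lambda> (\<lambda>_. count_space {-1, 1})"

(* Every unordered pair is counted once; the product over a pair {i, j} is sigma_i * sigma_j. *)
definition ising_weight :: "real \<Rightarrow> (int ^ 'd::finite) set \<Rightarrow> (int ^ 'd \<Rightarrow> int) \<Rightarrow> real" where
  "ising_weight J \<Lambda> \<sigma> =
     exp (J * (\<Sum>e\<in>{e \<in> nn_pairs. e \<inter> \<Lambda> \<noteq> {}}. \<Prod>i\<in>e. real_of_int (\<sigma> i)))"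

(* The probability of eta on Lambda under the boundary condition sigma outside Lambda. *)
definition ising_kernel ::
  "real \<Rightarrow> (int ^ 'd::finite) set \<Rightarrow> (int ^ 'd \<Rightarrow> int) \<Rightarrow> (int ^ 'd \<Rightarrow> int) \<Rightarrow> real" where
  "ising_kernel J \<Lambda> \<sigma> \<eta> =
     ising_weight J \<Lambda> (override_on \<sigma> \<eta> \<Lambda>) /
     (\<Sum>\<zeta>\<in>\<Lambda> \<rightarrow>\<^sub>E {-1, 1}. ising_weight J \<Lambda> (override_on \<sigma> \<zeta> \<Lambda>))"

(* The sigma-algebra generated by the spins outside Lambda. *)
definition outside_algebra :: "'s set \<Rightarrow> ('s \<Rightarrow> int) measure" where
  "outside_algebra \<Lambda> =
     vimage_algebra (space (spins UNIV)) (\<lambda>\<sigma>. restrict \<sigma> (- \<Lambda>)) (spins (- \<Lambda>))"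

definition ising_gibbs :: "real \<Rightarrow> (int ^ 'd::finite \<Rightarrow> int) measure \<Rightarrow> bool" where
  "ising_gibbs J \<mu> \<longleftrightarrow>
     prob_space \<mu> \<and> sets \<mu> = sets (spins UNIV) \<and>
     (\<forall>\<Lambda>. finite \<Lambda> \<longrightarrow> (\<forall>\<eta> \<in> \<Lambda> \<rightarrow>\<^sub>E {-1, 1}.
        AE \<sigma> in \<mu>. real_cond_exp \<mu> (outside_algebra \<Lambda>)
                       (indicat_real {\<tau>. \<forall>i\<in>\<Lambda>. \<tau> i = \<eta> i}) \<sigma>
                    = ising_kernel J \<Lambda> \<sigma> \<eta>))"

section \<open>Polylogarithms of negative order\<close>

(* polylog_neg k is Li_(1-k). On the real line away from the pole 1 the pointwise derivative is
   that of the rational function; only negative arguments are used. *)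
definition polylog_neg :: "nat \<Rightarrow> real \<Rightarrow> real" where
  "polylog_neg k = ((\<lambda>f z. z * deriv f z) ^^ (k - 1)) (\<lambda>z. z / (1 - z))"

definition r2 :: "nat \<Rightarrow> real" where
  "r2 n = (GREATEST z. z < 0 \<and> polylog_neg n z = 0)"

end

theory Submission
  imports Defs "HOL-Computational_Algebra.Polynomial" "HOL-Real_Asymp.Real_Asymp"
begin

text \<open>
  Let \<open>n = 2 d\<close>, let \<open>N\<close> be the set of neighbours of the origin and \<open>D\<close> the set of neighbours
  of \<open>N\<close> other than the origin. The single-site Gibbs conditions give
  \<open>P (X = 0 on D \<union> C) = c * A ^ (n - j) * (1 + exp (x0 + (n - j) * s))\<close> for \<open>C \<subseteq> N\<close> with \<open>j\<close>
  elements, where \<open>x0 = - 4 d J\<close> and \<open>s > 0\<close>. If \<open>X\<close> comes from a Poisson process with intensity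
  \<open>\<nu>\<close>, the negative logarithm of this probability is the \<open>\<nu>\<close>-measure of the sets hitting \<open>D \<union> C\<close>, so
  by inclusion-exclusion the forward differences with step \<open>s\<close> and of orders \<open>2, \<dots>, n\<close> of the
  softplus function \<open>ln (1 + exp x)\<close> at \<open>x0\<close> are measures of sets, hence nonnegative.

  The \<open>m\<close>-th difference has exactly \<open>m - 2\<close> zeros, and the zeros for consecutive orders interlace
  with gaps larger than \<open>s\<close>. Hence nonnegativity up to order \<open>n\<close> means that \<open>x0\<close> lies to the left
  of the first zero of the \<open>n\<close>-th difference. This zero moves strictly to the right as \<open>s\<close> decreases,
  and for \<open>s \<rightarrow> 0\<close> it tends to the first zero of the \<open>n\<close>-th derivative of softplus. That
  derivative is \<open>- Li_(1-n) (- exp x)\<close>, so \<open>exp x0 < - r2 n\<close>, against the hypothesis.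
\<close>

section \<open>Forward differences\<close>

primrec fd :: "real \<Rightarrow> (real \<Rightarrow> real) \<Rightarrow> nat \<Rightarrow> real \<Rightarrow> real" where
  "fd s f 0 x = f x"
| "fd s f (Suc m) x = fd s f m (x + s) - fd s f m x"

text \<open>Differences commute, so the first one may be taken innermost. This is the form needed
  for inductions that vary the function.\<close>

lemma fd_Suc_inner: "fd s f (Suc m) x = fd s (\<lambda>y. f (y + s) - f y) m x"
proof (induction m arbitrary: x)
  case (Suc m)
  show ?case
    by (subst fd.simps(2), subst (1 2) Suc.IH) simp
qed simp

lemma fd_diff: "fd s (\<lambda>x. f x - g x) m x = fd s f m x - fd s g m x"
  by (induction m arbitrary: x) simp_all

lemma fd_tendsto_at_bot:
  assumes "(f \<longlongrightarrow> 0) at_bot"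
  shows "(fd s f m \<longlongrightarrow> 0) at_bot"
proof (induction m)
  case 0
  have "fd s f 0 = f" by auto
  then show ?case using assms by simp
next
  case (Suc m)
  have "filterlim (\<lambda>x. x + s) at_bot at_bot"
    unfolding filterlim_at_bot eventually_at_bot_linorder
    by (metis add.commute le_diff_eq)
  from filterlim_compose[OF Suc this]
  have "((\<lambda>x. fd s f m (x + s) - fd s f m x) \<longlongrightarrow> 0 - 0) at_bot"
    by (intro tendsto_diff Suc)
  then show ?case by (simp add: fun_eq_iff[symmetric])
qed

lemma fd_tendsto_at_top:
  assumes "(f \<longlongrightarrow> 0) at_top"
  shows "(fd s f m \<longlongrightarrow> 0) at_top"
proof (induction m)
  case 0
  have "fd s f 0 = f" by auto
  then show ?case using assms by simp
next
  case (Suc m)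
  have "filterlim (\<lambda>x. x + s) at_top at_top"
    unfolding filterlim_at_top eventually_at_top_linorder
    by (metis diff_le_eq)
  from filterlim_compose[OF Suc this]
  have "((\<lambda>x. fd s f m (x + s) - fd s f m x) \<longlongrightarrow> 0 - 0) at_top"
    by (intro tendsto_diff Suc)
  then show ?case by (simp add: fun_eq_iff[symmetric])
qed

lemma fd_has_real_derivative:
  assumes "\<And>x. (f has_real_derivative f' x) (at x)"
  shows "(fd s f m has_real_derivative fd s f' m x) (at x)"
proof (induction m arbitrary: x)
  case 0
  then show ?case using assms by simp
next
  case (Suc m)
  have "((\<lambda>x. fd s f m (x + s)) has_real_derivative fd s f' m (x + s)) (at x)"
    using Suc[of "x + s"] by (simp add: DERIV_shift)
  then show ?case using Suc[of x] by (auto intro!: derivative_intros)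
qed

text \<open>With E the shift by \<open>s\<close>, \<open>fd\<close> is (E - 1)^m, and dE/ds = E d/dx
  produces the factor m (E - 1)^(m - 1) E applied to \<open>f'\<close>. The offset
  \<open>a * s\<close> makes the induction close, because the outer shift turns \<open>a\<close>
  into \<open>a + 1\<close>.\<close>

lemma fd_has_real_derivative_step:
  assumes "\<And>x. (f has_real_derivative f' x) (at x)"
  shows "((\<lambda>s. fd s f m (x + a * s)) has_real_derivative
           real m * fd s f' (m - 1) (x + a * s + s) + a * fd s f' m (x + a * s)) (at s)"
proof (induction m arbitrary: a)
  case 0
  have "((\<lambda>s. f (x + a * s)) has_real_derivative f' (x + a * s) * a) (at s)"
    by (rule DERIV_chain2[OF assms]) (auto intro!: derivative_eq_intros)
  then show ?case by (simp add: mult.commute)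
next
  case (Suc m)
  have *: "((\<lambda>s. fd s f m (x + (a + 1) * s) - fd s f m (x + a * s)) has_real_derivative
     (real m * fd s f' (m - 1) (x + (a + 1) * s + s) + (a + 1) * fd s f' m (x + (a + 1) * s))
     - (real m * fd s f' (m - 1) (x + a * s + s) + a * fd s f' m (x + a * s))) (at s)"
    by (intro DERIV_diff Suc)
  have "real m * (fd s f' (m - 1) (x + a * s + s + s) - fd s f' (m - 1) (x + a * s + s))
      = real m * fd s f' m (x + a * s + s)"
    by (cases m) auto
  then show ?case
    using * by (simp add: algebra_simps)
qed

text \<open>Induction over the whole chain \<open>F\<close> of derivatives: the first differences of
  its members form such a chain again, and the mean value theorem turns the one remaining difference
  into \<open>s\<close> times a derivative.\<close>

lemma fd_mean_value:
  assumes "s > 0" "\<And>m x. (F m has_real_derivative F (Suc m) x) (at x)"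
  shows "\<exists>\<xi>\<in>{x..x + real m * s}. fd s (F 0) m x = s ^ m * F m \<xi>"
  using assms(2)
proof (induction m arbitrary: F)
  case 0
  then show ?case by auto
next
  case (Suc m)
  let ?H = "\<lambda>k y. F k (y + s) - F k y"
  have "(?H k has_real_derivative ?H (Suc k) y) (at y)" for k y
    using Suc.prems[of k "y + s"] Suc.prems[of k y]
    by (auto intro!: DERIV_diff simp: DERIV_shift)
  from Suc.IH[of ?H, OF this] obtain \<xi> where
    \<xi>: "\<xi> \<in> {x..x + real m * s}" "fd s (?H 0) m x = s ^ m * (F m (\<xi> + s) - F m \<xi>)" by blast
  obtain \<eta> where \<eta>: "\<xi> < \<eta>" "\<eta> < \<xi> + s" "F m (\<xi> + s) - F m \<xi> = s * F (Suc m) \<eta>"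
    using MVT2[of \<xi> "\<xi> + s" "F m" "F (Suc m)"] assms(1) Suc.prems by auto
  have "fd s (F 0) (Suc m) x = s ^ Suc m * F (Suc m) \<eta>"
    unfolding fd_Suc_inner using \<xi>(2) \<eta>(3) by simp
  moreover have "\<eta> \<in> {x..x + real (Suc m) * s}"
    using \<xi>(1) \<eta> by (auto simp: algebra_simps)
  ultimately show ?case by blast
qed

section \<open>Counting zeros with the mean value theorem\<close>

lemma IVT_sign_change:
  fixes g :: "real \<Rightarrow> real"
  assumes "continuous_on UNIV g" "a < b" "g a * g b < 0"
  shows "\<exists>c. a < c \<and> c < b \<and> g c = 0"
proof -
  have *: "continuous_on {a..b} g" "continuous_on {a..b} (\<lambda>x. - g x)"
    using assms(1) by (auto intro: continuous_on_subset continuous_intros)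
  from assms(3) consider "g a < 0" "g b > 0" | "g a > 0" "g b < 0"
    by (auto simp: mult_less_0_iff)
  then have "\<exists>c. a \<le> c \<and> c \<le> b \<and> g c = 0"
  proof cases
    case 1
    then show ?thesis using IVT'[of g a 0 b] * assms(2) by auto
  next
    case 2
    then show ?thesis using IVT'[of "\<lambda>x. - g x" a 0 b] * assms(2) by auto
  qed
  then show ?thesis using assms(3) by (metis less_eq_real_def mult_eq_0_iff order_less_irrefl)
qed

text \<open>A function that does not start downwards but ends lower has a negative slope somewhere
  in between, so its continuous slope passes through zero.\<close>

lemma deriv_zero_ge:
  fixes f :: "real \<Rightarrow> real"
  assumes f: "\<And>x. (f has_real_derivative f' x) (at x)" and cont: "continuous_on UNIV f'"
    and "f' a \<ge> 0" "a < b" "f b < f a"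
  shows "\<exists>c\<ge>a. c < b \<and> f' c = 0"
proof (cases "f' a = 0")
  case False
  obtain c where c: "a < c" "c < b" "f b - f a = (b - a) * f' c"
    using MVT2[of a b f f'] assms by blast
  have "f' c < 0"
    using c assms(4,5) by (smt (verit) mult_nonneg_nonneg)
  then obtain y where "a < y" "y < c" "f' y = 0"
    using IVT_sign_change[OF cont c(1)] False assms(3) by (auto simp: mult_less_0_iff)
  then show ?thesis using c by (intro exI[of _ y]) auto
qed (use assms in auto)

lemma Rolle_deriv:
  fixes f :: "real \<Rightarrow> real"
  assumes "\<And>x. (f has_real_derivative f' x) (at x)" "a < b" "f a = f b"
  shows "\<exists>c. a < c \<and> c < b \<and> f' c = 0"
proof -
  obtain c where "a < c" "c < b" "f b - f a = (b - a) * f' c"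
    using MVT2[of a b f f'] assms by blast
  then show ?thesis using assms by auto
qed

text \<open>Rolle with infinity as the second zero. If \<open>f (a + 1)\<close> is nonzero, the
  slope has its sign somewhere before \<open>a + 1\<close> and the opposite sign later, once the
  absolute value of \<open>f\<close> has dropped.\<close>

lemma Rolle_at_top:
  fixes f :: "real \<Rightarrow> real"
  assumes f: "\<And>x. (f has_real_derivative f' x) (at x)"
    and lim: "(f \<longlongrightarrow> 0) at_top" and cont: "continuous_on UNIV f'"
    and a: "f a = 0"
  shows "\<exists>c>a. f' c = 0"
proof (cases "f (a + 1) = 0")
  case True
  then show ?thesis using Rolle_deriv[OF f, of a "a + 1"] a by auto
next
  case False
  have "eventually (\<lambda>y. \<bar>f y\<bar> < \<bar>f (a + 1)\<bar>) at_top"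
    using lim False by (auto simp: tendsto_iff dist_real_def)
  then obtain N where "\<And>y. y \<ge> N \<Longrightarrow> \<bar>f y\<bar> < \<bar>f (a + 1)\<bar>"
    by (auto simp: eventually_at_top_linorder)
  then obtain y where y: "y > a + 1" "\<bar>f y\<bar> < \<bar>f (a + 1)\<bar>"
    by (metis gt_ex le_max_iff_disj less_max_iff_disj max.cobounded1 order.strict_trans1)
  obtain c where c: "a < c" "c < a + 1" "f (a + 1) - f a = (a + 1 - a) * f' c"
    using MVT2[of a "a + 1" f f'] f by auto
  obtain e where e: "a + 1 < e" "e < y" "f y - f (a + 1) = (y - (a + 1)) * f' e"
    using MVT2[of "a + 1" y f f'] f y by auto
  have "f (a + 1) * (f y - f (a + 1)) < 0"
    using y(2) False by (smt (verit) mult_less_0_iff)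
  then have "f (a + 1) * f' e < 0"
    using e(3) y(1) by (simp add: mult_less_0_iff zero_less_mult_iff)
  then have "f' c * f' e < 0" using c a by simp
  moreover have "c < e" using c e by linarith
  ultimately obtain d where "c < d" "f' d = 0"
    using IVT_sign_change[OF cont, of c e] by blast
  then show ?thesis using c(1) by (intro exI[of _ d]) auto
qed

lemma Rolle_at_bot:
  fixes f :: "real \<Rightarrow> real"
  assumes f: "\<And>x. (f has_real_derivative f' x) (at x)"
    and lim: "(f \<longlongrightarrow> 0) at_bot" and cont: "continuous_on UNIV f'"
    and a: "f a = 0"
  shows "\<exists>c<a. f' c = 0"
proof -
  have "((\<lambda>x. f (- x)) has_real_derivative f' (- x) * (- 1)) (at x)" for x
    by (rule DERIV_chain2[OF f]) (auto intro!: derivative_eq_intros)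
  then have "((\<lambda>x. f (- x)) has_real_derivative - f' (- x)) (at x)" for x
    by simp
  moreover have "((\<lambda>x. f (- x)) \<longlongrightarrow> 0) at_top"
    using lim by (simp add: filterlim_at_bot_mirror)
  moreover have "continuous_on UNIV (\<lambda>x. - f' (- x))"
    by (intro continuous_intros continuous_on_compose2[OF cont]) auto
  ultimately obtain c where "c > - a" "- f' (- c) = 0"
    using Rolle_at_top[of "\<lambda>x. f (- x)" "\<lambda>x. - f' (- x)" "- a"] a by auto
  then show ?thesis by (intro exI[of _ "- c"]) auto
qed

text \<open>The limit at infinity counts as one more zero, so no zero is lost in passing to
  \<open>f'\<close>. Zeros are added from the right end: each new leftmost one gives a critical
  point before the next zero, while all earlier critical points lie after that zero.\<close>

lemma Rolle_count_right:
  fixes f :: "real \<Rightarrow> real"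
  assumes f: "\<And>x. (f has_real_derivative f' x) (at x)"
    and lim: "(f \<longlongrightarrow> 0) at_top" and cont: "continuous_on UNIV f'"
    and "finite A" "\<And>a. a \<in> A \<Longrightarrow> f a = 0"
  shows "\<exists>B. finite B \<and> card B = card A \<and> (\<forall>b\<in>B. f' b = 0 \<and> (\<exists>a\<in>A. a < b))"
  using assms(4,5)
proof (induction A rule: finite_linorder_min_induct)
  case empty
  then show ?case by (intro exI[of _ "{}"]) auto
next
  case (insert b A)
  then obtain B where B: "finite B" "card B = card A" "\<forall>b\<in>B. f' b = 0 \<and> (\<exists>a\<in>A. a < b)"
    by auto
  have bA: "b \<notin> A" using insert by blast
  have "\<exists>c>b. f' c = 0 \<and> c \<notin> B"
  proof (cases "A = {}")
    case True
    then have "B = {}" using B by blast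
    then show ?thesis using Rolle_at_top[OF f lim cont, of b] insert by auto
  next
    case False
    define a where "a = Min A"
    have a: "a \<in> A" "\<And>y. y \<in> A \<Longrightarrow> a \<le> y" using False insert by (auto simp: a_def)
    obtain c where "b < c" "c < a" "f' c = 0"
      using Rolle_deriv[OF f, of b a] insert a by auto
    moreover have "c \<notin> B" using B a \<open>c < a\<close> by (meson less_le_trans not_less_iff_gr_or_eq)
    ultimately show ?thesis by blast
  qed
  then obtain c where "c > b" "f' c = 0" "c \<notin> B" by blast
  then show ?case using B insert bA
    by (intro exI[of _ "insert c B"]) auto
qed

text \<open>The critical points are taken strictly between consecutive zeros. Their disjointness
  from \<open>A\<close> later lets a double root be counted as an additional critical point.\<close>

lemma Rolle_count_between:
  fixes f :: "real \<Rightarrow> real"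
  assumes f: "\<And>x. (f has_real_derivative f' x) (at x)"
    and "finite A" "A \<noteq> {}" "\<And>a. a \<in> A \<Longrightarrow> f a = 0"
  shows "\<exists>B. finite B \<and> card A = Suc (card B) \<and> B \<inter> A = {} \<and>
           (\<forall>b\<in>B. f' b = 0 \<and> Min A < b \<and> b < Max A)"
  using assms(2-)
proof (induction A rule: finite_linorder_max_induct)
  case (insert b A)
  show ?case
  proof (cases "A = {}")
    case True
    then show ?thesis by (intro exI[of _ "{}"]) auto
  next
    case False
    with insert obtain B where B: "finite B" "card A = Suc (card B)" "B \<inter> A = {}"
      "\<forall>b\<in>B. f' b = 0 \<and> Min A < b \<and> b < Max A" by auto
    have MA: "Max A \<in> A" "Min A \<in> A" "Min A \<le> Max A" using False insert by auto
    then have lt: "Max A < b" using insert by blast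
    then obtain c where c: "Max A < c" "c < b" "f' c = 0"
      using Rolle_deriv[OF f, of "Max A" b] insert MA by auto
    have "c \<notin> A" using c(1) insert(1) by (meson Max_ge not_le)
    moreover have "c \<notin> B" using c(1) B by force
    moreover have "b \<notin> B" "b \<notin> A" using B lt insert by force+
    moreover have "Min (insert b A) = Min A" "Max (insert b A) = b"
      using False insert(1,2) lt MA by (auto intro!: Min_eqI Max_eqI less_imp_le)
    moreover have "Min A < c" using MA c by linarith
    then have "\<forall>x\<in>insert c B. f' x = 0 \<and> Min A < x \<and> x < b"
      using B(4) c lt by (metis insert_iff less_trans)
    ultimately show ?thesis using B c insert(1)
      by (intro exI[of _ "insert c B"]) (simp del: Min_less_iff Max_less_iff)
  qed
qed auto

lemma tendsto_at_top_neg_of_deriv_pos: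
  fixes f :: "real \<Rightarrow> real"
  assumes f: "\<And>x. (f has_real_derivative f' x) (at x)"
    and lim: "(f \<longlongrightarrow> 0) at_top" and pos: "\<And>x. x \<ge> N \<Longrightarrow> f' x > 0" and x: "x \<ge> N"
  shows "f x < 0"
proof -
  have mono: "f u < f v" if "N \<le> u" "u < v" for u v
    using DERIV_pos_imp_increasing[OF that(2), of f] f pos that by (meson order.trans)
  have "eventually (\<lambda>y. f (x + 1) \<le> f y) at_top"
    unfolding eventually_at_top_linorder using mono x
    by (intro exI[of _ "x + 1"]) (metis add_increasing2 less_eq_real_def zero_le_one)
  then have "f (x + 1) \<le> 0"
    using tendsto_lowerbound[OF lim] by simp
  then show ?thesis using mono[of x "x + 1"] x by simp
qed

lemma tendsto_at_bot_pos_of_deriv_pos: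
  fixes f :: "real \<Rightarrow> real"
  assumes f: "\<And>x. (f has_real_derivative f' x) (at x)"
    and lim: "(f \<longlongrightarrow> 0) at_bot" and pos: "\<And>x. x \<le> N \<Longrightarrow> f' x > 0" and x: "x \<le> N"
  shows "f x > 0"
proof -
  have "((\<lambda>x. - f (- x)) has_real_derivative - (f' (- x) * (- 1))) (at x)" for x
    by (intro DERIV_minus DERIV_chain2[OF f]) (auto intro!: derivative_eq_intros)
  then have "((\<lambda>x. - f (- x)) has_real_derivative f' (- x)) (at x)" for x
    by simp
  moreover have "((\<lambda>x. - f (- x)) \<longlongrightarrow> 0) at_top"
    using tendsto_minus[OF lim] by (simp add: filterlim_at_bot_mirror)
  ultimately have "- f (- (- x)) < 0"
    by (rule tendsto_at_top_neg_of_deriv_pos[where N = "- N"]) (use pos x in auto)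
  then show ?thesis by simp
qed

section \<open>Zeros of the differences of softplus\<close>

definition softplus :: "real \<Rightarrow> real" where "softplus x = ln (1 + exp x)"

definition logistic :: "real \<Rightarrow> real" where "logistic x = exp x / (1 + exp x)"

lemma one_plus_exp_pos [simp]: "1 + exp (x::real) > 0" "1 + exp (x::real) \<noteq> 0"
  using exp_gt_zero[of x] by (simp_all add: add_pos_pos add_nonneg_eq_0_iff)

lemma softplus_has_real_derivative:
  "(softplus has_real_derivative logistic x) (at x)"
  unfolding softplus_def[abs_def] logistic_def
  by (auto intro!: derivative_eq_intros)

lemma logistic_has_real_derivative:
  "(logistic has_real_derivative logistic x * (1 - logistic x)) (at x)"
proof -
  have "(logistic has_real_derivative
      (exp x * (1 + exp x) - exp x * exp x) / ((1 + exp x) * (1 + exp x))) (at x)"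
    unfolding logistic_def[abs_def] by (rule derivative_eq_intros refl | simp)+
  moreover have "(exp x * (1 + exp x) - exp x * exp x) / ((1 + exp x) * (1 + exp x))
      = logistic x * (1 - logistic x)"
  proof -
    have "1 - logistic x = 1 / (1 + exp x)" by (simp add: logistic_def diff_divide_eq_iff)
    moreover have "exp x * (1 + exp x) - exp x * exp x = exp x" by (simp add: algebra_simps)
    ultimately show ?thesis by (simp only: logistic_def times_divide_times_eq mult_1_right)
  qed
  ultimately show ?thesis by simp
qed

lemma continuous_logistic: "continuous_on A logistic"
  unfolding logistic_def[abs_def] by (intro continuous_intros) simp

lemma continuous_softplus: "continuous_on A softplus"
  unfolding softplus_def[abs_def] by (intro continuous_intros) simp_all

lemma continuous_fd:
  assumes "continuous_on UNIV f"
  shows "continuous_on A (fd s f m)"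
proof -
  have "continuous_on UNIV (fd s f m)"
  proof (induction m)
    case 0
    have "fd s f 0 = f" by auto
    then show ?case using assms by simp
  next
    case (Suc m)
    have "fd s f (Suc m) = (\<lambda>x. fd s f m (x + s) - fd s f m x)" by auto
    moreover have "continuous_on UNIV (\<lambda>x. fd s f m (x + s))"
      by (rule continuous_on_compose2[OF Suc]) (auto intro!: continuous_intros)
    ultimately show ?case by (simp add: continuous_on_diff Suc)
  qed
  then show ?thesis by (rule continuous_on_subset) simp
qed

lemma softplus_tendsto_at_bot: "(softplus \<longlongrightarrow> 0) at_bot"
  unfolding softplus_def[abs_def] by real_asymp

lemma softplus_reflect: "softplus x = x + softplus (- x)"
proof -
  have "1 + exp x = exp x * (1 + exp (- x))" by (simp add: distrib_left flip: exp_add)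
  then have "ln (1 + exp x) = ln (exp x * (1 + exp (- x)))" by (rule arg_cong)
  then show ?thesis unfolding softplus_def by (subst (asm) ln_mult) simp_all
qed

text \<open>Softplus differs from its reflection, which decays at infinity, by a linear function,
  and differences of order at least two annihilate that function.\<close>

lemma fd_softplus_tendsto_at_top:
  assumes "m \<ge> 2"
  shows "(fd s softplus m \<longlongrightarrow> 0) at_top"
proof -
  define k where "k = m - 2"
  have k: "m = Suc (Suc k)" using assms by (simp add: k_def)
  define g where "g = (\<lambda>x. softplus (- x))"
  have "(g \<longlongrightarrow> 0) at_top"
    using softplus_tendsto_at_bot by (simp add: g_def filterlim_at_bot_mirror)
  then have "(fd s g m \<longlongrightarrow> 0) at_top" by (rule fd_tendsto_at_top)
  moreover have "fd s softplus m = fd s g m"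
  proof
    fix x
    have const: "fd s (\<lambda>x. c) (Suc k) x = 0" for k c x
    proof (induction k arbitrary: x)
      case (Suc k)
      show ?case by (subst fd.simps(2)) (simp only: Suc.IH diff_self)
    qed simp
    have "softplus (y + s) - softplus y = s - (g y - g (y + s))" for y
      using softplus_reflect[of "y + s"] softplus_reflect[of y] by (simp only: g_def)
    then have "fd s softplus m x = fd s (\<lambda>y. s - (g y - g (y + s))) (Suc k) x"
      unfolding k by (subst fd_Suc_inner) (simp only:)
    also have "\<dots> = fd s (\<lambda>y. 0 - (g y - g (y + s))) (Suc k) x"
      unfolding fd_diff[of s "\<lambda>y. s"] fd_diff[of s "\<lambda>y. 0"] by (simp only: const)
    also have "\<dots> = fd s g m x"
      unfolding k fd_Suc_inner[of s g] by simp
    finally show "fd s softplus m x = fd s g m x" .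
  qed
  ultimately show ?thesis by simp
qed

text \<open>
  With \<open>z = exp x\<close> and \<open>q = exp s\<close>, the difference of order \<open>k + 1\<close> of the logistic function is
  \<open>z\<close> times this polynomial in \<open>z\<close>, divided by the product of the \<open>1 + z * q ^ i\<close>.
\<close>

primrec fd_num :: "real \<Rightarrow> nat \<Rightarrow> real poly" where
  "fd_num q 0 = [:q - 1:]"
| "fd_num q (Suc k) = [:1, 1:] * smult q (pcompose (fd_num q k) [:0, q:])
     - [:1, q ^ (k + 2):] * fd_num q k"

lemma fd_logistic_eq:
  "fd s logistic (Suc k) x =
     exp x * poly (fd_num (exp s) k) (exp x) / (\<Prod>i\<le>Suc k. 1 + exp (x + real i * s))"
proof (induction k arbitrary: x)
  case 0
  show ?case
    by (simp add: logistic_def divide_simps) (simp add: algebra_simps exp_add)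
next
  case (Suc k)
  define z q where "z = exp x" and "q = exp s"
  \<comment> \<open>\<open>P\<close> collects the factors common to the denominators at
    \<open>x\<close> and at \<open>x + s\<close>.\<close>
  define P where "P = (\<Prod>i\<in>{1..Suc k}. 1 + exp (x + real i * s))"
  define N where "N = poly (fd_num q k)"
  have P: "P > 0" unfolding P_def by (intro prod_pos) simp
  have e0: "(\<Prod>i\<le>Suc k. 1 + exp (x + real i * s)) = (1 + z) * P"
    unfolding P_def z_def atMost_atLeast0 by (subst prod.atLeast_Suc_atMost) simp_all
  have ek: "exp (x + real (k + 2) * s) = z * q ^ (k + 2)"
    unfolding z_def q_def exp_add exp_of_nat_mult[symmetric] ..
  have e2: "(\<Prod>i\<le>Suc (Suc k). 1 + exp (x + real i * s)) = (1 + z) * P * (1 + z * q ^ (k + 2))"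
    using e0 ek by (simp add: prod.atMost_Suc)
  have "(\<Prod>i\<le>Suc k. 1 + exp (x + s + real i * s)) = (\<Prod>i\<in>{1..Suc (Suc k)}. 1 + exp (x + real i * s))"
    by (rule prod.reindex_bij_witness[of _ "\<lambda>i. i - 1" Suc]) (auto simp: algebra_simps of_nat_diff)
  also have "\<dots> = P * (1 + z * q ^ (k + 2))"
    unfolding P_def using ek by (simp add: prod.nat_ivl_Suc')
  finally have e1: "(\<Prod>i\<le>Suc k. 1 + exp (x + s + real i * s)) = P * (1 + z * q ^ (k + 2))" .
  have "fd s logistic (Suc (Suc k)) x
      = q * z * N (q * z) / (P * (1 + z * q ^ (k + 2))) - z * N z / ((1 + z) * P)"
    unfolding fd.simps(2)[of _ _ "Suc k"] Suc.IH[of x] Suc.IH[of "x + s"] e0 e1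
    by (simp add: N_def z_def q_def exp_add mult_ac)
  also have "\<dots> = z * (q * N (q * z) * (1 + z) - N z * (1 + z * q ^ (k + 2)))
                    / ((1 + z) * P * (1 + z * q ^ (k + 2)))"
  proof -
    have "1 + z > 0" "1 + z * q ^ (k + 2) > 0" by (auto simp: z_def q_def intro!: add_pos_pos)
    then show ?thesis using P by (simp add: divide_simps) (simp add: algebra_simps)
  qed
  also have "q * N (q * z) * (1 + z) - N z * (1 + z * q ^ (k + 2)) = poly (fd_num q (Suc k)) z"
    by (simp add: N_def poly_pcompose algebra_simps)
  finally show ?case unfolding e2 unfolding z_def q_def .
qed

text \<open>The recursion multiplies the top coefficient by \<open>q ^ (k + 1) * (1 - q)\<close> and
  the constant one by \<open>q - 1\<close>. The degree bounds the number of zeros, and the two signs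
  give the behaviour at the two ends of the line.\<close>

lemma fd_num_coeffs:
  assumes "q > 1"
  shows "degree (fd_num q k) \<le> k \<and> (-1) ^ k * coeff (fd_num q k) k > 0 \<and> coeff (fd_num q k) 0 > 0"
proof (induction k)
  case 0
  then show ?case using assms by simp
next
  case (Suc k)
  define p where "p = fd_num q k"
  define r where "r = pcompose p [:0, q:]"
  have q0: "q > 0" "q \<noteq> 0" using assms by auto
  have IH: "degree p \<le> k" "(-1) ^ k * coeff p k > 0" "coeff p 0 > 0" using Suc by (auto simp: p_def)
  have cr: "coeff r i = q ^ i * coeff p i" for i
    unfolding r_def by (simp add: coeff_pcompose_linear)
  have dr: "degree r \<le> k" unfolding r_def using IH(1) by (simp add: degree_pcompose)
  have eq: "fd_num q (Suc k) = smult q (pCons 0 r) + smult q r - pCons 0 (smult (q ^ (k + 2)) p) - p"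
    by (simp add: p_def r_def algebra_simps smult_add_right)
  have "degree (fd_num q (Suc k)) \<le> Suc k"
    unfolding eq using dr IH(1)
    by (intro degree_diff_le degree_add_le order.trans[OF degree_smult_le] order.trans[OF degree_pCons_le]) auto
  moreover have "coeff p (Suc k) = 0" using IH(1) by (intro coeff_eq_0) auto
  then have ck: "coeff (fd_num q (Suc k)) (Suc k) = - (q ^ (k + 1) * (q - 1) * coeff p k)"
    unfolding eq by (simp add: cr algebra_simps)
  then have "(-1) ^ Suc k * coeff (fd_num q (Suc k)) (Suc k) > 0"
  proof -
    have "0 < q ^ (k + 1) * (q - 1)" using assms by simp
    from mult_pos_pos[OF this IH(2)] show ?thesis
      unfolding ck by (simp add: mult_ac)
  qed
  moreover have "coeff (fd_num q (Suc k)) 0 = (q - 1) * coeff p 0"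
    unfolding eq by (simp add: cr algebra_simps)
  ultimately show ?case using IH(3) assms by simp
qed

declare fd.simps(2) [simp del]

section \<open>Signs and zero counts of the logistic differences\<close>

lemma fd_logistic_sign:
  "0 < c * fd s logistic (Suc k) x \<longleftrightarrow> 0 < c * poly (fd_num (exp s) k) (exp x)"
  "fd s logistic (Suc k) x = 0 \<longleftrightarrow> poly (fd_num (exp s) k) (exp x) = 0"
proof -
  define P where "P = (\<Prod>i\<le>Suc k. 1 + exp (x + real i * s))"
  have P: "P > 0" unfolding P_def by (intro prod_pos) simp
  have eq: "fd s logistic (Suc k) x = (exp x / P) * poly (fd_num (exp s) k) (exp x)"
    unfolding fd_logistic_eq P_def[symmetric] by simp
  have pos: "exp x / P > 0" using P by simp
  show "0 < c * fd s logistic (Suc k) x \<longleftrightarrow> 0 < c * poly (fd_num (exp s) k) (exp x)"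
    unfolding eq using pos by (simp only: mult.left_commute[of c] zero_less_mult_iff) auto
  show "fd s logistic (Suc k) x = 0 \<longleftrightarrow> poly (fd_num (exp s) k) (exp x) = 0"
    unfolding eq using pos by (simp only: mult_eq_0_iff) auto
qed

lemma fd_logistic_zeros:
  assumes "s > 0"
  shows "finite {x. fd s logistic (Suc k) x = 0}" "card {x. fd s logistic (Suc k) x = 0} \<le> k"
proof -
  let ?p = "fd_num (exp s) k"
  let ?Z = "{x. fd s logistic (Suc k) x = 0}"
  have c: "degree ?p \<le> k" "coeff ?p 0 > 0" using fd_num_coeffs[of "exp s" k] assms by auto
  then have "?p \<noteq> 0" by auto
  then have fin: "finite {z. poly ?p z = 0}" and "card {z. poly ?p z = 0} \<le> degree ?p"
    by (auto intro: poly_roots_finite card_poly_roots_bound)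
  have im: "exp ` ?Z \<subseteq> {z. poly ?p z = 0}" using fd_logistic_sign(2) by auto
  have inj: "inj_on exp ?Z" by (auto intro: inj_onI)
  show "finite ?Z" using finite_imageD[OF finite_subset[OF im fin] inj] .
  have "card ?Z = card (exp ` ?Z)" using card_image[OF inj] by simp
  also have "\<dots> \<le> k" using card_mono[OF fin im] \<open>card _ \<le> degree ?p\<close> c(1) by linarith
  finally show "card ?Z \<le> k" .
qed

lemma fd_logistic_pos_at_bot:
  assumes "s > 0"
  shows "\<exists>N. \<forall>x\<le>N. fd s logistic (Suc k) x > 0"
proof -
  let ?p = "fd_num (exp s) k"
  have "poly ?p 0 > 0" using fd_num_coeffs[of "exp s" k] assms by (simp add: poly_0_coeff_0)
  moreover have "((\<lambda>x::real. poly ?p (exp x)) \<longlongrightarrow> poly ?p 0) at_bot"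
    by (intro tendsto_poly exp_at_bot)
  ultimately have "eventually (\<lambda>x. poly ?p (exp x) > 0) at_bot"
    by (simp add: order_tendstoD(1))
  then show ?thesis
    using fd_logistic_sign(1)[of 1 s k] by (auto simp: eventually_at_bot_linorder)
qed

lemma fd_logistic_sign_at_top:
  assumes "s > 0"
  shows "\<exists>N. \<forall>x\<ge>N. (-1) ^ k * fd s logistic (Suc k) x > 0"
proof -
  let ?p = "smult ((-1) ^ k) (fd_num (exp s) k)"
  have "degree ?p \<le> k" "coeff ?p k > 0"
    using fd_num_coeffs[of "exp s" k] assms by auto
  then have lc: "lead_coeff ?p > 0"
    by (metis le_antisym le_degree less_numeral_extra(3))
  obtain N where N: "\<And>z. z \<ge> N \<Longrightarrow> poly ?p z \<ge> lead_coeff ?p"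
    using poly_pinfty_gt_lc[OF lc] by auto
  have "0 < (-1) ^ k * fd s logistic (Suc k) x" if "x \<ge> N" for x
  proof -
    have "exp x \<ge> N" using exp_ge_add_one_self[of x] that by linarith
    from N[OF this] lc have "poly ?p (exp x) > 0" by linarith
    then show ?thesis unfolding fd_logistic_sign(1) by simp
  qed
  then show ?thesis by blast
qed

section \<open>Transfer of signs and zero counts to softplus\<close>

lemmas fd_softplus_deriv = fd_has_real_derivative[OF softplus_has_real_derivative]

lemmas continuous_fd_logistic = continuous_fd[OF continuous_logistic]

text \<open>The difference tends to 0 at both ends. By Rolle its derivative therefore has at least
  one zero more than it has itself, and the derivative has at most \<open>k + 1\<close>
  zeros.\<close>

lemma fd_softplus_zeros:
  assumes "s > 0"
  shows "finite {x. fd s softplus (Suc (Suc k)) x = 0}"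
    "card {x. fd s softplus (Suc (Suc k)) x = 0} \<le> k"
proof -
  let ?f = "fd s softplus (Suc (Suc k))" and ?f' = "fd s logistic (Suc (Suc k))"
  have top: "(?f \<longlongrightarrow> 0) at_top" by (rule fd_softplus_tendsto_at_top) simp
  have bot: "(?f \<longlongrightarrow> 0) at_bot" by (rule fd_tendsto_at_bot[OF softplus_tendsto_at_bot])
  have count: "card A \<le> k" if A: "finite A" "A \<subseteq> {x. ?f x = 0}" for A
  proof (cases "A = {}")
    case False
    obtain B where B: "finite B" "card B = card A" "\<forall>b\<in>B. ?f' b = 0 \<and> (\<exists>a\<in>A. a < b)"
      using Rolle_count_right[OF fd_softplus_deriv top continuous_fd_logistic A(1)] A(2) by auto
    have "?f (Min A) = 0" using A False Min_in by blast
    then obtain c where c: "c < Min A" "?f' c = 0"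
      using Rolle_at_bot[OF fd_softplus_deriv bot continuous_fd_logistic] by blast
    have "c \<notin> B" using c(1) B(3) A(1) by (meson Min_le leD less_trans not_less)
    then have "Suc (card A) = card (insert c B)" using B by simp
    also have "\<dots> \<le> card {x. ?f' x = 0}"
      using B c by (intro card_mono fd_logistic_zeros assms) auto
    also have "\<dots> \<le> Suc k" by (rule fd_logistic_zeros[OF assms])
    finally show ?thesis by simp
  qed simp
  show "finite {x. ?f x = 0}"
  proof (rule ccontr)
    assume "infinite {x. ?f x = 0}"
    then obtain A where "finite A" "card A = Suc k" "A \<subseteq> {x. ?f x = 0}"
      by (meson infinite_arbitrarily_large)
    then show False using count[of A] by simp
  qed
  then show "card {x. ?f x = 0} \<le> k" using count by blast
qed

lemma fd_softplus_pos_at_bot: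
  assumes "s > 0"
  shows "\<exists>N. \<forall>x\<le>N. fd s softplus (Suc k) x > 0"
proof -
  obtain N where N: "\<And>x. x \<le> N \<Longrightarrow> fd s logistic (Suc k) x > 0"
    using fd_logistic_pos_at_bot[OF assms] by blast
  show ?thesis
    using tendsto_at_bot_pos_of_deriv_pos[OF fd_softplus_deriv
        fd_tendsto_at_bot[OF softplus_tendsto_at_bot] N] by blast
qed

lemma fd_softplus_sign_at_top:
  assumes "s > 0"
  shows "\<exists>N. \<forall>x\<ge>N. (-1) ^ k * fd s softplus (Suc (Suc k)) x > 0"
proof -
  define c :: real where "c = (-1) ^ Suc k"
  let ?f = "fd s softplus (Suc (Suc k))" and ?f' = "fd s logistic (Suc (Suc k))"
  obtain N where N: "\<And>x. x \<ge> N \<Longrightarrow> c * ?f' x > 0"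
    using fd_logistic_sign_at_top[OF assms, of "Suc k"] unfolding c_def by blast
  have d: "((\<lambda>x. c * ?f x) has_real_derivative c * ?f' x) (at x)" for x
    by (rule DERIV_cmult[OF fd_softplus_deriv])
  have "((\<lambda>x. c * ?f x) \<longlongrightarrow> 0) at_top"
    by (rule tendsto_mult_right_zero[OF fd_softplus_tendsto_at_top]) simp
  from tendsto_at_top_neg_of_deriv_pos[OF d this N]
  have "c * ?f x < 0" if "x \<ge> N" for x using that by blast
  then show ?thesis unfolding c_def by (intro exI[of _ N]) simp
qed

text \<open>The zeros are indexed by \<open>1, \<dots>, k\<close>; the guards let \<open>a 0\<close> and \<open>a (k + 1)\<close> stand for
  \<open>-\<infinity>\<close> and \<open>\<infinity>\<close>.\<close>

definition alternating_zeros :: "real \<Rightarrow> (real \<Rightarrow> real) \<Rightarrow> nat \<Rightarrow> (nat \<Rightarrow> real) \<Rightarrow> bool" where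
  "alternating_zeros s f k a \<longleftrightarrow>
     (\<forall>i. 1 \<le> i \<longrightarrow> i < k \<longrightarrow> a i + s < a (Suc i)) \<and> (\<forall>i\<in>{1..k}. f (a i) = 0) \<and>
     (\<forall>i\<le>k. \<forall>x. (1 \<le> i \<longrightarrow> a i < x) \<longrightarrow> (i < k \<longrightarrow> x < a (Suc i)) \<longrightarrow> (-1) ^ i * f x > 0)"

lemma alternating_zerosD:
  assumes "alternating_zeros s f k a"
  shows "1 \<le> i \<Longrightarrow> i < k \<Longrightarrow> a i + s < a (Suc i)"
    and "1 \<le> i \<Longrightarrow> i \<le> k \<Longrightarrow> f (a i) = 0"
    and "i \<le> k \<Longrightarrow> (1 \<le> i \<Longrightarrow> a i < x) \<Longrightarrow> (i < k \<Longrightarrow> x < a (Suc i)) \<Longrightarrow> (-1) ^ i * f x > 0"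
  using assms unfolding alternating_zeros_def by auto

lemma increasing_from_consecutive:
  fixes b :: "nat \<Rightarrow> real"
  assumes "\<And>i. 1 \<le> i \<Longrightarrow> i < n \<Longrightarrow> b i < b (Suc i)" "1 \<le> i" "i < j" "j \<le> n"
  shows "b i < b j"
  using assms(3,4)
proof (induction j)
  case (Suc j)
  then show ?case using assms(1)[of j] assms(2) by (cases "i = j") (auto intro: less_trans)
qed simp

text \<open>The next difference is \<open>g x = f (x + s) - f x\<close>. Since the zeros of
  \<open>f\<close> are more than \<open>s\<close> apart, \<open>g\<close> has the sign
  \<open>(-1) ^ i\<close> both at \<open>a i\<close> and at \<open>a i - s\<close>. Together with
  the signs at the ends this forces a zero of \<open>g\<close> between \<open>a (i - 1)\<close> and
  \<open>a i - s\<close> for each \<open>i\<close>, with the outer bounds read as infinite. These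
  are \<open>k + 1\<close> zeros, as many as there can be.\<close>

lemma alternating_zeros_step:
  assumes s: "s > 0" and a: "alternating_zeros s (fd s softplus (Suc (Suc k))) k a"
  shows "\<exists>b. alternating_zeros s (fd s softplus (Suc (Suc (Suc k)))) (Suc k) b \<and>
             (k \<ge> 1 \<longrightarrow> b 1 + s < a 1 \<and> a 1 < b 2)"
proof -
  let ?f = "fd s softplus (Suc (Suc k))"
  define g where "g = fd s softplus (Suc (Suc (Suc k)))"
  have g: "g x = ?f (x + s) - ?f x" for x by (simp add: g_def fd.simps(2)[of _ _ "Suc (Suc k)"])
  note gap = alternating_zerosD(1)[OF a] and zero = alternating_zerosD(2)[OF a]
    and sign = alternating_zerosD(3)[OF a]
  have g1: "(-1) ^ i * g (a i) > 0" if "1 \<le> i" "i \<le> k" for i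
    using sign[of i "a i + s"] zero[OF that] gap that s by (simp add: g)
  have g2: "(-1) ^ i * g (a i - s) > 0" if i: "1 \<le> i" "i \<le> k" for i
  proof -
    obtain j where j: "i = Suc j" using i by (cases i) auto
    have "(-1) ^ j * ?f (a i - s) > 0"
      using i s gap[of j] unfolding j by (intro sign) (auto simp: less_diff_eq)
    then show ?thesis using zero[OF i] by (simp add: g j)
  qed
  obtain NL where NL: "\<And>x. x \<le> NL \<Longrightarrow> g x > 0"
    using fd_softplus_pos_at_bot[OF s] unfolding g_def by blast
  obtain NR where NR: "\<And>x. x \<ge> NR \<Longrightarrow> (-1) ^ Suc k * g x > 0"
    using fd_softplus_sign_at_top[OF s, of "Suc k"] unfolding g_def by blast
  \<comment> \<open>The intervals from \<open>l i\<close> to \<open>r i\<close> bracket the new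
    zeros. \<open>NL\<close> and \<open>NR\<close> replace the infinite ends, and the further terms
    in the minimum and maxima keep \<open>l i < r i\<close>, also for \<open>k = 0\<close>.\<close>
  define l where "l i = (if i = 1 then min NL (a 1 - s - 1) else a (i - 1))" for i
  define r where "r i = (if i = Suc k then max NR (max (a k) NL) + 1 else a i - s)" for i
  have lr: "l i < r i" if "1 \<le> i" "i \<le> Suc k" for i
  proof -
    obtain j where j: "i = Suc j" using \<open>1 \<le> i\<close> by (cases i) auto
    show ?thesis using that gap[of j] s unfolding j by (auto simp: l_def r_def less_diff_eq)
  qed
  have gl: "(-1) ^ (i - 1) * g (l i) > 0" if "1 \<le> i" "i \<le> Suc k" for i
    using that NL[of "l 1"] g1[of "i - 1"] by (auto simp: l_def)
  have gr: "(-1) ^ i * g (r i) > 0" if "1 \<le> i" "i \<le> Suc k" for i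
    using that NR[of "r (Suc k)"] g2[of i] by (auto simp: r_def)
  have contg: "continuous_on UNIV g" unfolding g_def by (rule continuous_fd[OF continuous_softplus])
  have "\<exists>b. l i < b \<and> b < r i \<and> g b = 0" if i: "1 \<le> i" "i \<le> Suc k" for i
  proof -
    obtain j where j: "i = Suc j" using i by (cases i) auto
    have "(-1) ^ j * g (l i) > 0" "(-1) ^ Suc j * g (r i) > 0"
      using gl[OF i] gr[OF i] j by simp_all
    then have "((-1) ^ j * g (l i)) * ((-1) ^ Suc j * g (r i)) > 0" by (rule mult_pos_pos)
    moreover have "((-1) ^ j * g (l i)) * ((-1) ^ Suc j * g (r i)) = - (g (l i) * g (r i))"
      by (cases "even j") simp_all
    ultimately have "- (g (l i) * g (r i)) > 0" by (simp only:)
    then have "g (l i) * g (r i) < 0" by simp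
    from IVT_sign_change[OF contg lr[OF i] this] show ?thesis .
  qed
  then obtain b where b: "\<And>i. 1 \<le> i \<Longrightarrow> i \<le> Suc k \<Longrightarrow> l i < b i \<and> b i < r i \<and> g (b i) = 0"
    by metis
  have bgap: "b i + s < a i" "a i < b (Suc i)" if "1 \<le> i" "i \<le> k" for i
    using that b[of i] b[of "Suc i"] by (auto simp: l_def r_def)
  have inc: "b i < b j" if "1 \<le> i" "i < j" "j \<le> Suc k" for i j
  proof (rule increasing_from_consecutive[of "Suc k" b, OF _ that])
    fix i assume "1 \<le> i" "i < Suc k"
    then show "b i < b (Suc i)" using bgap[of i] s by linarith
  qed
  have "inj_on b {1..Suc k}"
    by (rule linorder_inj_onI) (use inc in force)+
  then have "card (b ` {1..Suc k}) = Suc k" by (simp add: card_image)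
  moreover have "b ` {1..Suc k} \<subseteq> {x. g x = 0}" using b by auto
  ultimately have zeros: "{x. g x = 0} = b ` {1..Suc k}"
    using fd_softplus_zeros[OF s, of "Suc k"] unfolding g_def[symmetric]
    by (metis card_seteq)
  have gsign: "(-1) ^ i * g x > 0"
    if i: "i \<le> Suc k" and x: "1 \<le> i \<Longrightarrow> b i < x" "i < Suc k \<Longrightarrow> x < b (Suc i)" for i x
  proof -
    \<comment> \<open>A point of the same gap at which the sign of \<open>g\<close> is already
      known. An opposite sign at \<open>x\<close> would create a zero inside the gap.\<close>
    define p where "p = (if i = 0 then l 1 else if i = Suc k then r (Suc k) else a i)"
    have p: "(-1) ^ i * g p > 0" "1 \<le> i \<Longrightarrow> b i < p" "i < Suc k \<Longrightarrow> p < b (Suc i)"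
      using i gl[of 1] gr[of "Suc k"] g1[of i] b[of 1] b[of "Suc k"] bgap[of i] s
      by (auto simp: p_def)
    have nz: "g y \<noteq> 0" if y: "1 \<le> i \<Longrightarrow> b i < y" "i < Suc k \<Longrightarrow> y < b (Suc i)" for y
    proof
      assume "g y = 0"
      then have "y \<in> b ` {1..Suc k}" using zeros by blast
      then obtain j where j: "1 \<le> j" "j \<le> Suc k" "y = b j" by auto
      show False
      proof (cases "j \<le> i")
        case True
        then have "b j \<le> b i" using inc[of j i] i j by (cases "j = i") auto
        then show False using y(1) j True by auto
      next
        case False
        then have "b (Suc i) \<le> b j" using inc[of "Suc i" j] i j by (cases "j = Suc i") auto
        then show False using y(2) j False by auto
      qed
    qed
    show ?thesis
    proof (rule ccontr)
      assume neg: "\<not> ?thesis"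
      have "(-1) ^ i * g x \<noteq> 0" using nz x by simp
      with neg have "(-1) ^ i * g x < 0" by linarith
      from mult_neg_pos[OF this p(1)] have "((-1) ^ i * (-1) ^ i) * (g x * g p) < 0"
        by (simp only: mult_ac)
      then have xp: "g x * g p < 0" by (simp flip: power_mult_distrib)
      show False
      proof (cases x p rule: linorder_cases)
        case less
        from IVT_sign_change[OF contg less xp] obtain y where "x < y" "y < p" "g y = 0" by blast
        then show False using nz[of y] x p by force
      next
        case greater
        from IVT_sign_change[OF contg greater] xp obtain y where "p < y" "y < x" "g y = 0"
          by (auto simp: mult.commute)
        then show False using nz[of y] x p by force
      next
        case equal
        then show False using neg p by simp
      qed
    qed
  qed
  have "alternating_zeros s g (Suc k) b"
    unfolding alternating_zeros_def
  proof (intro conjI allI impI ballI)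
    fix i assume "1 \<le> i" "i < Suc k"
    then show "b i + s < b (Suc i)" using bgap[of i] by linarith
  qed (use b gsign in auto)
  moreover have "k \<ge> 1 \<longrightarrow> b 1 + s < a 1 \<and> a 1 < b 2" using bgap[of 1] by (simp add: numeral_2_eq_2)
  ultimately show ?thesis unfolding g_def by blast
qed

text \<open>
  To the left of its first zero the difference has a single critical point, since another one
  would exceed the bound on the number of zeros of the derivative.
\<close>

lemma fd_logistic_neg_past_peak:
  assumes s: "s > 0" and a: "alternating_zeros s (fd s softplus (Suc (Suc k))) k a"
    and c: "fd s softplus (Suc (Suc k)) (c + s) = fd s softplus (Suc (Suc k)) c"
    and ca: "1 \<le> k \<Longrightarrow> c + s < a 1"
  shows "fd s logistic (Suc (Suc k)) (c + s) < 0"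
proof (rule ccontr)
  let ?f = "fd s softplus (Suc (Suc k))" and ?f' = "fd s logistic (Suc (Suc k))"
  assume "\<not> ?f' (c + s) < 0"
  then have nn: "?f' (c + s) \<ge> 0" by simp
  have d: "\<And>x. (?f has_real_derivative ?f' x) (at x)" by (rule fd_softplus_deriv)
  have top: "(?f \<longlongrightarrow> 0) at_top" by (rule fd_softplus_tendsto_at_top) simp
  \<comment> \<open>First critical point: equal values at \<open>c\<close> and
    \<open>c + s\<close>.\<close>
  obtain e where e: "c < e" "e < c + s" "?f' e = 0"
    using Rolle_deriv[OF d, of c "c + s"] c s by auto
  note gap = alternating_zerosD(1)[OF a] and zero = alternating_zerosD(2)[OF a]
    and sign = alternating_zerosD(3)[OF a]
  have pos: "?f (c + s) > 0" using sign[of 0 "c + s"] ca by simp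
  \<comment> \<open>Second critical point: a function that is positive and not decreasing at
    \<open>c + s\<close> must still turn before it comes down to its zero \<open>a 1\<close>, or to
    its limit 0 when there is no zero.\<close>
  have "\<exists>u\<ge>c + s. (k \<ge> 1 \<longrightarrow> u < a 1) \<and> ?f' u = 0"
  proof (cases "k \<ge> 1")
    case True
    then have "?f (a 1) = 0" using zero[of 1] by simp
    then show ?thesis
      using deriv_zero_ge[OF d continuous_fd_logistic nn ca[OF True]] pos by auto
  next
    case False
    have "eventually (\<lambda>y. y > c + s \<and> ?f y < ?f (c + s)) at_top"
      by (intro eventually_conj eventually_gt_at_top order_tendstoD(2)[OF top pos])
    then obtain y where "y > c + s" "?f y < ?f (c + s)"
      by (auto simp: eventually_at_top_linorder)
    then show ?thesis
      using deriv_zero_ge[OF d continuous_fd_logistic nn] False by auto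
  qed
  then obtain u where u: "u \<ge> c + s" "k \<ge> 1 \<Longrightarrow> u < a 1" "?f' u = 0" by blast
  have inc: "a i < a j" if "1 \<le> i" "i < j" "j \<le> k" for i j
  proof (rule increasing_from_consecutive[of k a, OF _ that])
    fix i assume "1 \<le> i" "i < k"
    then show "a i < a (Suc i)" using gap[of i] s by linarith
  qed
  have "inj_on a {1..k}"
    by (rule linorder_inj_onI) (use inc in force)+
  then have cA: "card (a ` {1..k}) = k" by (simp add: card_image)
  have za: "?f y = 0" if "y \<in> a ` {1..k}" for y
  proof -
    from that obtain i where "y = a i" "1 \<le> i" "i \<le> k" by auto
    then show ?thesis by (simp only: zero)
  qed
  have fin: "finite (a ` {1..k})" by simp
  \<comment> \<open>\<open>k\<close> further critical points, all to the right of \<open>a 1\<close>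
    and hence of \<open>u\<close>. With \<open>e\<close> and \<open>u\<close> there are
    \<open>k + 2\<close>, one too many.\<close>
  from Rolle_count_right[where f = ?f, OF d top continuous_fd_logistic fin za]
  obtain B where "finite B \<and> card B = card (a ` {1..k}) \<and>
      (\<forall>b\<in>B. ?f' b = 0 \<and> (\<exists>y\<in>a ` {1..k}. y < b))" ..
  then have B: "finite B" "card B = k" "\<forall>b\<in>B. ?f' b = 0 \<and> (\<exists>y\<in>a ` {1..k}. y < b)"
    unfolding cA by (rule conjunct1, rule conjunct2[THEN conjunct1], rule conjunct2[THEN conjunct2])
  have Bu: "u < b" if b: "b \<in> B" for b
  proof -
    obtain y where "y \<in> a ` {1..k}" "y < b" using bspec[OF B(3) b] by (elim conjE bexE)
    then obtain i where "i \<in> {1..k}" "a i < b" by auto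
    then have i: "1 \<le> i" "i \<le> k" "a i < b" by auto
    then have "a 1 \<le> a i" using inc[of 1 i] by (cases "i = 1") auto
    then show ?thesis using u(2) i by auto
  qed
  have "e \<notin> B" "u \<notin> B" "e \<noteq> u" using Bu[of e] Bu[of u] e u(1) by auto
  then have "card (insert e (insert u B)) = Suc (Suc k)" using B by simp
  moreover have "card (insert e (insert u B)) \<le> card {x. ?f' x = 0}"
    using B e(3) u(3) by (intro card_mono fd_logistic_zeros s) auto
  ultimately show False using fd_logistic_zeros(2)[OF s, of "Suc k"] by linarith
qed

text \<open>By interlacing, the first zero moves left by more than \<open>s\<close> with each order,
  so lower orders are still positive up to the first zero of the top order. That zero says that the
  difference of one order less takes equal values at \<open>a 1\<close> and \<open>a 1 + s\<close>,
  so its peak is passed at \<open>a 1 + s\<close>; this gives the last clause.\<close>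

lemma fd_softplus_first_zero:
  assumes s: "s > 0"
  shows "\<exists>a. alternating_zeros s (fd s softplus (k + 3)) (Suc k) a \<and>
    (\<forall>x. (\<forall>j\<in>{2..k + 3}. fd s softplus j x \<ge> 0) \<longrightarrow> x \<le> a 1) \<and>
    (\<forall>x\<le>a 1. \<forall>j\<in>{2..k + 2}. fd s softplus j x > 0) \<and>
    fd s logistic (k + 2) (a 1 + s) < 0"
proof (induction k)
  case 0
  let ?D = "fd s softplus"
  obtain N where N: "\<And>x. x \<le> N \<Longrightarrow> ?D 2 x > 0"
    using fd_softplus_pos_at_bot[OF s, of 1] by (auto simp: numeral_2_eq_2)
  have nz: "?D 2 x \<noteq> 0" for x
    using fd_softplus_zeros[OF s, of 0] by (auto simp: numeral_2_eq_2)
  \<comment> \<open>The second difference has no zeros and is positive far to the left.\<close>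
  have pos: "?D 2 x > 0" for x
  proof (rule ccontr)
    assume neg: "\<not> ?D 2 x > 0"
    then have "N < x" "?D 2 x < 0" using N[of x] nz[of x] by linarith+
    then show False
      using IVT_sign_change[of "?D 2" N x] continuous_fd[OF continuous_softplus] nz N[of N]
      by (auto simp: mult_pos_neg)
  qed
  \<comment> \<open>With no zeros to list, the sequence is a dummy.\<close>
  have az: "alternating_zeros s (?D (Suc (Suc 0))) 0 (\<lambda>_. 0)"
    using pos unfolding alternating_zeros_def by (auto simp: numeral_2_eq_2)
  obtain b where b: "alternating_zeros s (?D (Suc (Suc (Suc 0)))) (Suc 0) b"
    using alternating_zeros_step[OF s az] by blast
  have "?D (Suc (Suc (Suc 0))) (b 1) = 0" using alternating_zerosD(2)[OF b, of 1] by simp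
  then have "fd s logistic (Suc (Suc 0)) (b 1 + s) < 0"
    by (intro fd_logistic_neg_past_peak[OF s az]) (simp_all only: fd.simps(2)[of _ _ "Suc (Suc 0)"])
  moreover have "x \<le> b 1" if "\<forall>j\<in>{2..3}. ?D j x \<ge> 0" for x
  proof (rule ccontr)
    assume "\<not> x \<le> b 1"
    then have "(-1) ^ Suc 0 * ?D (Suc (Suc (Suc 0))) x > 0"
      by (intro alternating_zerosD(3)[OF b]) auto
    moreover have "?D (Suc (Suc (Suc 0))) x \<ge> 0" using that by (simp add: numeral_3_eq_3)
    ultimately show False by simp
  qed
  moreover have "?D j x > 0" if "j \<in> {2..2}" for j x using that pos by auto
  ultimately show ?case using b by (intro exI[of _ b]) (simp add: numeral_3_eq_3 numeral_2_eq_2)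
next
  case (Suc k)
  let ?D = "fd s softplus"
  obtain a where az: "alternating_zeros s (?D (k + 3)) (Suc k) a"
    and a1: "\<And>x. (\<And>j. j \<in> {2..k + 3} \<Longrightarrow> ?D j x \<ge> 0) \<Longrightarrow> x \<le> a 1"
    and a2: "\<And>x j. x \<le> a 1 \<Longrightarrow> j \<in> {2..k + 2} \<Longrightarrow> ?D j x > 0"
    using Suc.IH by blast
  have k3: "k + 3 = Suc (Suc (Suc k))" by simp
  obtain b where bz: "alternating_zeros s (?D (k + 4)) (Suc (Suc k)) b"
    and b: "b 1 + s < a 1" "a 1 < b 2"
    using alternating_zeros_step[OF s az[unfolded k3]] by (auto simp: eval_nat_numeral)
  have "?D (k + 4) (b 1) = 0" using alternating_zerosD(2)[OF bz, of 1] by simp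
  then have "?D (Suc (Suc (Suc k))) (b 1 + s) = ?D (Suc (Suc (Suc k))) (b 1)"
    using fd.simps(2)[of s softplus "Suc (Suc (Suc k))" "b 1"]
    by (simp add: eval_nat_numeral)
  from fd_logistic_neg_past_peak[OF s az[unfolded k3] this] b(1)
  have 1: "fd s logistic (Suc k + 2) (b 1 + s) < 0" by simp
  \<comment> \<open>The lower orders confine \<open>x\<close> to \<open>x \<le> a 1 < b 2\<close>.
    Between \<open>b 1\<close> and \<open>b 2\<close> the top difference is negative.\<close>
  have 2: "x \<le> b 1" if x: "\<forall>j\<in>{2..Suc k + 3}. ?D j x \<ge> 0" for x
  proof (rule ccontr)
    assume "\<not> x \<le> b 1"
    moreover have "x \<le> a 1" using x by (intro a1) auto
    ultimately have "(-1) ^ 1 * ?D (k + 4) x > 0"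
      using b by (intro alternating_zerosD(3)[OF bz]) (auto simp: numeral_2_eq_2)
    moreover have "?D (k + 4) x \<ge> 0" using x by auto
    ultimately show False by simp
  qed
  have 3: "?D j x > 0" if x: "x \<le> b 1" and j: "j \<in> {2..Suc k + 2}" for x j
  proof (cases "j = k + 3")
    case True
    have "(-1) ^ 0 * ?D (k + 3) x > 0"
      using x b s by (intro alternating_zerosD(3)[OF az]) auto
    then show ?thesis using True by simp
  next
    case False
    then show ?thesis using a2 x b s j by auto
  qed
  have "Suc k + 3 = k + 4" by simp
  then show ?case using bz 1 2 3 by (intro exI[of _ b] conjI) (auto simp: add.commute)
qed

text \<open>Nonnegativity up to order \<open>n\<close> means that \<open>x\<close> does not exceed
  the first zero of the top order, so only the top order can vanish at \<open>x\<close>. The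
  negative quantity in the last conclusion is, up to the factor \<open>n\<close>, the derivative of
  the top difference with respect to the step.\<close>

lemma fd_softplus_nonneg_imp:
  assumes s: "s > 0" and n: "n \<ge> 3" and x: "\<And>j. j \<in> {2..n} \<Longrightarrow> fd s softplus j x \<ge> 0"
  shows "\<And>y j. y < x \<Longrightarrow> j \<in> {2..n} \<Longrightarrow> fd s softplus j y > 0"
    and "\<And>j. j \<in> {2..<n} \<Longrightarrow> fd s softplus j x > 0"
    and "fd s softplus n x = 0 \<Longrightarrow> fd s logistic (n - 1) (x + s) < 0"
proof -
  define k where "k = n - 3"
  have nk: "n = k + 3" using n by (simp add: k_def)
  obtain a where az: "alternating_zeros s (fd s softplus (k + 3)) (Suc k) a"
    and a1: "\<forall>x. (\<forall>j\<in>{2..k + 3}. fd s softplus j x \<ge> 0) \<longrightarrow> x \<le> a 1"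
    and a2: "\<forall>x\<le>a 1. \<forall>j\<in>{2..k + 2}. fd s softplus j x > 0"
    and a3: "fd s logistic (k + 2) (a 1 + s) < 0"
    using fd_softplus_first_zero[OF s, of k] by (elim exE conjE) (rule that; assumption)
  note az = az[folded nk] and a1 = a1[rule_format, folded nk, OF x] and a2 = a2[rule_format]
  have pos: "fd s softplus n y > 0" if "y < a 1" for y
  proof -
    have "(-1) ^ 0 * fd s softplus n y > 0"
      using that by (intro alternating_zerosD(3)[OF az]) auto
    then show ?thesis by simp
  qed
  show "fd s softplus j y > 0" if "y < x" "j \<in> {2..n}" for y j
    using that pos[of y] a2[of y j] a1 nk by (cases "j = n") auto
  show "fd s softplus j x > 0" if "j \<in> {2..<n}" for j
    using that a2[of x j] a1 nk by auto
  show "fd s logistic (n - 1) (x + s) < 0" if "fd s softplus n x = 0"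
  proof -
    have "x = a 1" using pos[of x] that a1 by force
    then show ?thesis using a3 nk by simp
  qed
qed

text \<open>Let \<open>t\<close> be the supremum of the steps below \<open>s0\<close> for which
  positivity fails. At \<open>t\<close> all orders are nonnegative, so at most order
  \<open>n\<close> vanishes there, and then it strictly decreases in the step. Hence positivity
  holds just below \<open>t\<close>, and failure at \<open>t\<close> itself would mean negativity
  just above it. Both contradict the choice of \<open>t\<close>.\<close>

lemma fd_softplus_pos_smaller_step:
  assumes s0: "s0 > 0" and n: "n \<ge> 3"
    and x: "\<And>j. j \<in> {2..n} \<Longrightarrow> fd s0 softplus j x \<ge> 0"
    and s: "0 < s" "s < s0" and j: "j \<in> {2..n}"
  shows "fd s softplus j x > 0"
proof (rule ccontr)
  assume neg: "\<not> fd s softplus j x > 0"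
  have deriv: "((\<lambda>s. fd s softplus m x) has_real_derivative
      real m * fd t logistic (m - 1) (x + t)) (at t)" for m :: nat and t
    using fd_has_real_derivative_step[OF softplus_has_real_derivative, where m = m and x = x and a = 0 and s = t] by simp
  then have cont: "isCont (\<lambda>s. fd s softplus m x) t" for m :: nat and t
    by (rule DERIV_isCont)
  define S where "S = {t. 0 < t \<and> t < s0 \<and> (\<exists>m\<in>{2..n}. fd t softplus m x \<le> 0)}"
  have sS: "s \<in> S" using s neg j unfolding S_def by force
  have bdd: "bdd_above S" unfolding S_def by (rule bdd_aboveI[of _ s0]) auto
  define t where "t = Sup S"
  have t: "s \<le> t" "t \<le> s0" "t > 0"
    using cSup_upper[OF sS bdd] s cSup_least[of S s0] sS unfolding t_def S_def by auto
  have above: "fd u softplus m x > 0" if "t < u" "u < s0" "m \<in> {2..n}" for u m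
  proof (rule ccontr)
    assume "\<not> ?thesis"
    then have "u \<in> S" using that t(3) unfolding S_def by (auto intro!: bexI[of _ m])
    from cSup_upper[OF this bdd] show False using that(1) unfolding t_def by simp
  qed
  \<comment> \<open>Limit of the positive values at larger steps, or the hypothesis itself if
    \<open>t = s0\<close>.\<close>
  have nn: "fd t softplus m x \<ge> 0" if m: "m \<in> {2..n}" for m
  proof (cases "t = s0")
    case False
    show ?thesis
    proof (rule tendsto_lowerbound)
      show "((\<lambda>s. fd s softplus m x) \<longlongrightarrow> fd t softplus m x) (at_right t)"
        using cont[of t m] unfolding isCont_def by (rule filterlim_mono) (auto simp: at_le)
      have "eventually (\<lambda>u. u \<in> {t<..<s0}) (at_right t)"
        using False t(2) by (intro eventually_at_right_real) auto
      then show "eventually (\<lambda>u. 0 \<le> fd u softplus m x) (at_right t)"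
        by eventually_elim (use above m in \<open>auto intro: less_imp_le\<close>)
    qed simp
  qed (use x m in simp)
  note nonneg_imp = fd_softplus_nonneg_imp[OF t(3) n nn]
  have left_pos: "\<exists>\<delta>>0. \<forall>u. t - \<delta> < u \<longrightarrow> u < t \<longrightarrow> fd u softplus m x > 0" if m: "m \<in> {2..n}" for m
  proof (cases "fd t softplus m x = 0")
    case False
    then have "fd t softplus m x > 0" using nn[OF m] by simp
    then have "eventually (\<lambda>u. fd u softplus m x > 0) (at t)"
      using cont[of t m] unfolding isCont_def by (rule order_tendstoD(1)[rotated])
    then obtain d where "d > 0" "\<forall>u. u \<noteq> t \<and> dist u t < d \<longrightarrow> fd u softplus m x > 0"
      unfolding eventually_at by auto
    then show ?thesis by (intro exI[of _ d]) (auto simp: dist_real_def)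
  next
    case True
    then have "m = n" using nonneg_imp(2)[of m] m by force
    have "fd t logistic (n - 1) (x + t) < 0" using nonneg_imp(3) True \<open>m = n\<close> by simp
    then have "real n * fd t logistic (n - 1) (x + t) < 0" using n by (simp add: mult_pos_neg)
    from DERIV_neg_dec_left[OF deriv this] obtain d where
      d: "d > 0" "\<And>h. 0 < h \<Longrightarrow> h < d \<Longrightarrow> fd t softplus n x < fd (t - h) softplus n x" by blast
    have "fd u softplus m x > 0" if "t - d < u" "u < t" for u
      using d(2)[of "t - u"] that True \<open>m = n\<close> by simp
    then show ?thesis using d(1) by blast
  qed
  then obtain \<delta> where \<delta>: "\<And>m. m \<in> {2..n} \<Longrightarrow> \<delta> m > 0"
    "\<And>m u. m \<in> {2..n} \<Longrightarrow> t - \<delta> m < u \<Longrightarrow> u < t \<Longrightarrow> fd u softplus m x > 0" by metis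
  \<comment> \<open>There are finitely many orders, so one interval to the left of \<open>t\<close>
    serves them all.\<close>
  define d where "d = Min (\<delta> ` {2..n})"
  have d: "d > 0" "\<And>m. m \<in> {2..n} \<Longrightarrow> d \<le> \<delta> m"
    unfolding d_def using \<delta>(1) n by (auto simp: Min_gr_iff)
  \<comment> \<open>Otherwise order \<open>n\<close> would vanish at \<open>t\<close> and become
    negative at slightly larger steps, against \<open>above\<close>.\<close>
  have "t \<notin> S"
  proof
    assume tS: "t \<in> S"
    then obtain m where m: "m \<in> {2..n}" "fd t softplus m x \<le> 0" and ts0: "t < s0" unfolding S_def by auto
    then have z: "fd t softplus m x = 0" using nn[OF m(1)] by simp
    then have mn: "m = n" using nonneg_imp(2)[of m] m by force
    have "fd t logistic (n - 1) (x + t) < 0" using nonneg_imp(3) z mn by simp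
    then have "real n * fd t logistic (n - 1) (x + t) < 0" using n by (simp add: mult_pos_neg)
    from DERIV_neg_dec_right[OF deriv this] obtain d where
      d: "d > 0" "\<And>h. 0 < h \<Longrightarrow> h < d \<Longrightarrow> fd t softplus n x > fd (t + h) softplus n x" by blast
    define h where "h = min (d / 2) ((s0 - t) / 2)"
    have "0 < h" "h < d" "t + h < s0" using d(1) ts0 unfolding h_def by (auto simp: min_def field_simps)
    then show False using d(2)[of h] above[of "t + h" n] z mn n by force
  qed
  moreover obtain u where u: "u \<in> S" "t - d < u"
    using less_cSup_iff[of S "t - d"] sS bdd d(1) unfolding t_def by auto
  moreover have "u \<le> t" using cSup_upper[OF u(1) bdd] unfolding t_def .
  ultimately have "u < t" by (metis less_eq_real_def)
  obtain m where m: "m \<in> {2..n}" "fd u softplus m x \<le> 0" using u(1) unfolding S_def by auto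
  show False using \<delta>(2)[OF m(1), of u] d(2)[OF m(1)] u(2) \<open>u < t\<close> m(2) by force
qed

section \<open>Polylogarithms and the limit of small steps\<close>

text \<open>\<open>cumulant_poly m\<close> is the cumulant of order \<open>m + 1\<close> of a Bernoulli variable, as a polynomial in
  its parameter.\<close>

primrec cumulant_poly :: "nat \<Rightarrow> real poly" where
  "cumulant_poly 0 = [:0, 1:]"
| "cumulant_poly (Suc m) = [:0, 1, -1:] * pderiv (cumulant_poly m)"

declare cumulant_poly.simps(2) [simp del]

lemma poly_cumulant_poly_Suc:
  "poly (cumulant_poly (Suc m)) p = poly (pderiv (cumulant_poly m)) p * (p * (1 - p))"
  by (simp add: cumulant_poly.simps(2) algebra_simps)

lemma degree_cumulant_poly: "degree (cumulant_poly m) = Suc m"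
proof (induction m)
  case (Suc m)
  then have "pderiv (cumulant_poly m) \<noteq> 0" by (simp add: pderiv_eq_0_iff)
  then have "degree ([:0, 1, -1:] * pderiv (cumulant_poly m))
      = degree [:0, 1, -1 :: real:] + degree (pderiv (cumulant_poly m))"
    by (intro degree_mult_eq) auto
  then show ?case using Suc by (simp add: cumulant_poly.simps(2) degree_pderiv del: mult_pCons_left)
qed simp

text \<open>Rolle gives a root of the derivative between any two consecutive roots, and the factor
  \<open>p * (1 - p)\<close> of the recursion puts 0 and 1 back. The count equals the degree, so
  these are all the roots.\<close>

lemma cumulant_poly_roots:
  "\<exists>A. finite A \<and> card A = Suc (Suc m) \<and> 0 \<in> A \<and> 1 \<in> A \<and> A \<subseteq> {0..1} \<and>
       (\<forall>p\<in>A. poly (cumulant_poly (Suc m)) p = 0)"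
proof (induction m)
  case 0
  show ?case by (intro exI[of _ "{0, 1}"]) (auto simp: cumulant_poly.simps(2))
next
  case (Suc m)
  let ?K = "cumulant_poly (Suc m)"
  from Suc.IH obtain A where "finite A \<and> card A = Suc (Suc m) \<and> 0 \<in> A \<and> 1 \<in> A \<and> A \<subseteq> {0..1} \<and>
       (\<forall>p\<in>A. poly ?K p = 0)" ..
  then have A: "finite A" "card A = Suc (Suc m)" "0 \<in> A" "1 \<in> A" "A \<subseteq> {0..1}"
    and Az: "\<And>p. p \<in> A \<Longrightarrow> poly ?K p = 0" by simp_all
  have "\<exists>B. finite B \<and> card A = Suc (card B) \<and> B \<inter> A = {} \<and>
      (\<forall>b\<in>B. poly (pderiv ?K) b = 0 \<and> Min A < b \<and> b < Max A)"
    using A(3) by (intro Rolle_count_between[where f = "poly ?K", OF poly_DERIV A(1)] Az) auto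
  then obtain B where "finite B \<and> card A = Suc (card B) \<and> B \<inter> A = {} \<and>
      (\<forall>b\<in>B. poly (pderiv ?K) b = 0 \<and> Min A < b \<and> b < Max A)" ..
  then have B: "finite B" "card A = Suc (card B)"
    "\<forall>b\<in>B. poly (pderiv ?K) b = 0 \<and> Min A < b \<and> b < Max A" by blast+
  have "Min A = 0" "Max A = 1" using A by (auto intro!: Min_eqI Max_eqI)
  then have "B \<subseteq> {0<..<1}" using B(3) by auto
  then have "0 \<notin> B" "1 \<notin> B" "B \<subseteq> {0..1}" by auto
  then show ?case using A B by (intro exI[of _ "insert 0 (insert 1 B)"]) (auto simp: cumulant_poly.simps(2)[of "Suc m"])
qed

text \<open>Rolle already yields \<open>m + 1\<close> critical points that are not roots, as many as
  the degree of the derivative. A double root would be one more.\<close>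

lemma cumulant_poly_simple_root:
  assumes "poly (cumulant_poly (Suc m)) \<rho> = 0"
  shows "poly (pderiv (cumulant_poly (Suc m))) \<rho> \<noteq> 0"
proof
  let ?K = "cumulant_poly (Suc m)"
  assume d0: "poly (pderiv ?K) \<rho> = 0"
  have deg: "degree ?K = Suc (Suc m)" by (rule degree_cumulant_poly)
  from cumulant_poly_roots[of m] obtain A where "finite A \<and> card A = Suc (Suc m) \<and> 0 \<in> A \<and>
       1 \<in> A \<and> A \<subseteq> {0..1} \<and> (\<forall>p\<in>A. poly ?K p = 0)" ..
  then have A: "finite A" "card A = Suc (Suc m)" "A \<noteq> {}"
    "\<And>p. p \<in> A \<Longrightarrow> poly ?K p = 0" by auto
  have "?K \<noteq> 0" using deg by auto
  then have "card {p. poly ?K p = 0} \<le> card A" "finite {p. poly ?K p = 0}"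
    using card_poly_roots_bound[of ?K] poly_roots_finite[of ?K] deg A(2)
    by auto
  then have "A = {p. poly ?K p = 0}" using A by (intro card_seteq) auto
  then have "\<rho> \<in> A" using assms by blast
  have "\<exists>B. finite B \<and> card A = Suc (card B) \<and> B \<inter> A = {} \<and>
      (\<forall>b\<in>B. poly (pderiv ?K) b = 0 \<and> Min A < b \<and> b < Max A)"
    by (rule Rolle_count_between[where f = "poly ?K", OF poly_DERIV A(1) A(3)]) (erule A(4))
  then obtain B where "finite B \<and> card A = Suc (card B) \<and> B \<inter> A = {} \<and>
      (\<forall>b\<in>B. poly (pderiv ?K) b = 0 \<and> Min A < b \<and> b < Max A)" ..
  then have B: "finite B" "card A = Suc (card B)" "B \<inter> A = {}"
    "\<forall>b\<in>B. poly (pderiv ?K) b = 0" by blast+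
  have p0: "pderiv ?K \<noteq> 0" using deg by (simp add: pderiv_eq_0_iff)
  have "Suc (Suc m) = card (insert \<rho> B)" using A B \<open>\<rho> \<in> A\<close> by (subst card_insert_disjoint) auto
  also have "\<dots> \<le> card {p. poly (pderiv ?K) p = 0}"
    using B d0 poly_roots_finite[OF p0] by (intro card_mono) auto
  also have "\<dots> \<le> degree (pderiv ?K)" by (rule card_poly_roots_bound[OF p0])
  also have "\<dots> = Suc m" using deg by (simp add: degree_pderiv)
  finally show False by simp
qed

text \<open>Under the substitution \<open>p = - z / (1 - z)\<close> the operator z d/dz becomes p (1
  - p) d/dp, the recursion of \<open>cumulant_poly\<close>, and the starting function z / (1 - z)
  becomes - p.\<close>

lemma polylog_neg_eq:
  assumes "z < 0"
  shows "polylog_neg (Suc m) z = - poly (cumulant_poly m) (- z / (1 - z))"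
  using assms
proof (induction m arbitrary: z)
  case 0
  then show ?case by (simp add: polylog_neg_def)
next
  case (Suc m)
  have step: "polylog_neg (Suc (Suc m)) z = z * deriv (polylog_neg (Suc m)) z"
    by (simp add: polylog_neg_def)
  have "((\<lambda>z. - z / (1 - z)) has_real_derivative - (1 / (1 - z)\<^sup>2)) (at z)"
    using Suc.prems by (auto intro!: derivative_eq_intros simp: power2_eq_square field_simps)
  from DERIV_chain2[OF poly_DERIV this, of "cumulant_poly m"]
  have "((\<lambda>z. - poly (cumulant_poly m) (- z / (1 - z))) has_real_derivative
      - (poly (pderiv (cumulant_poly m)) (- z / (1 - z)) * - (1 / (1 - z)\<^sup>2))) (at z)"
    by (rule DERIV_minus)
  \<comment> \<open>The induction hypothesis covers negative arguments only; these form a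
    neighbourhood of \<open>z\<close>, which is enough for the derivative.\<close>
  moreover have "eventually (\<lambda>w. w \<in> {..<0}) (nhds z)"
    using Suc.prems by (intro eventually_nhds_in_open) auto
  then have "eventually (\<lambda>w. polylog_neg (Suc m) w = - poly (cumulant_poly m) (- w / (1 - w))) (nhds z)"
    by eventually_elim (rule Suc.IH, simp)
  ultimately have "(polylog_neg (Suc m) has_real_derivative
      - (poly (pderiv (cumulant_poly m)) (- z / (1 - z)) * - (1 / (1 - z)\<^sup>2))) (at z)"
    by (subst DERIV_cong_ev[OF refl _ refl])
  then have "deriv (polylog_neg (Suc m)) z = poly (pderiv (cumulant_poly m)) (- z / (1 - z)) / (1 - z)\<^sup>2"
    by (simp add: DERIV_imp_deriv)
  then have "polylog_neg (Suc (Suc m)) z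
      = (z / (1 - z)\<^sup>2) * poly (pderiv (cumulant_poly m)) (- z / (1 - z))"
    by (simp add: step)
  also have "z / (1 - z)\<^sup>2 = - ((- z / (1 - z)) * (1 - (- z / (1 - z))))"
    using Suc.prems by (simp add: field_simps power2_eq_square)
  finally show ?case unfolding poly_cumulant_poly_Suc by (simp only: mult_minus_left mult.commute)
qed

text \<open>The value of \<open>GREATEST\<close> is meaningful because the set of negative roots is
  finite and nonempty: of the \<open>n\<close> roots of the cumulant polynomial in the unit
  interval, one differs from 0 and 1.\<close>

lemma r2_root:
  assumes "n \<ge> 3"
  shows "r2 n < 0 \<and> poly (cumulant_poly (n - 1)) (- r2 n / (1 - r2 n)) = 0"
proof -
  define m where "m = n - 3"
  have n: "n = Suc (Suc (Suc m))" using assms by (simp add: m_def)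
  let ?K = "cumulant_poly (Suc (Suc m))"
  let ?Z = "{z. z < 0 \<and> polylog_neg n z = 0}"
  have iff: "polylog_neg n z = 0 \<longleftrightarrow> poly ?K (- z / (1 - z)) = 0" if "z < 0" for z
    using polylog_neg_eq[OF that, of "Suc (Suc m)"] by (simp add: n)
  from cumulant_poly_roots[of "Suc m"] obtain A where "finite A \<and> card A = Suc (Suc (Suc m)) \<and>
       0 \<in> A \<and> 1 \<in> A \<and> A \<subseteq> {0..1} \<and> (\<forall>p\<in>A. poly ?K p = 0)" ..
  then have A: "finite A" "card A = Suc (Suc (Suc m))" "A \<subseteq> {0..1}"
    "\<And>p. p \<in> A \<Longrightarrow> poly ?K p = 0" by auto
  have "\<not> A \<subseteq> {0, 1}"
  proof
    assume "A \<subseteq> {0, 1}"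
    then have "card A \<le> card {0, 1 :: real}" by (intro card_mono) auto
    then show False using A(2) by simp
  qed
  then obtain p where "p \<in> A" "p \<noteq> 0" "p \<noteq> 1" by auto
  then have p: "0 < p" "p < 1" "poly ?K p = 0" using A(3,4) by force+
  \<comment> \<open>Inverse of the substitution \<open>p = - z / (1 - z)\<close>.\<close>
  define z where "z = - (p / (1 - p))"
  have "z < 0" using p by (simp add: z_def)
  have "1 - z = 1 / (1 - p)" using p by (simp add: z_def field_simps)
  then have "- z / (1 - z) = p" using p by (simp add: z_def)
  with iff[OF \<open>z < 0\<close>] p(3) \<open>z < 0\<close> have ne: "z \<in> ?Z" by simp
  have inj: "inj_on (\<lambda>z. - z / (1 - z)) ?Z"
    by (rule inj_onI) (simp add: divide_simps algebra_simps split: if_splits)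
  have "?K \<noteq> 0" using degree_cumulant_poly[of "Suc (Suc m)"] by (metis degree_0 nat.distinct(1))
  then have "finite {p. poly ?K p = 0}" by (rule poly_roots_finite)
  then have fin: "finite ?Z"
    by (rule finite_imageD[OF finite_subset inj, rotated]) (use iff in auto)
  have "r2 n = Max ?Z"
    unfolding r2_def
    by (rule Greatest_equality) (use Max_in[OF fin] Max_ge[OF fin] ne in blast)+
  then have "r2 n \<in> ?Z" using Max_in[OF fin] ne by auto
  then show ?thesis using iff[of "r2 n"] by (simp add: n)
qed

section \<open>From differences to derivatives of softplus\<close>

lemma softplus_iterated_deriv:
  "((case m of 0 \<Rightarrow> softplus | Suc k \<Rightarrow> \<lambda>x. poly (cumulant_poly k) (logistic x)) has_real_derivative
    poly (cumulant_poly m) (logistic x)) (at x)"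
proof (cases m)
  case 0
  then show ?thesis using softplus_has_real_derivative by simp
next
  case (Suc k)
  have "((\<lambda>x. poly (cumulant_poly k) (logistic x)) has_real_derivative
     poly (pderiv (cumulant_poly k)) (logistic x) * (logistic x * (1 - logistic x))) (at x)"
    by (rule DERIV_chain2[OF poly_DERIV logistic_has_real_derivative])
  then show ?thesis unfolding Suc nat.case poly_cumulant_poly_Suc .
qed

text \<open>A difference is a power of the step times the derivative of the same order at a nearby
  point. A negative derivative at \<open>y\<close> would thus make it negative for small
  steps.\<close>

lemma cumulant_nonneg_of_fd:
  assumes "s1 > 0" and "\<And>s. 0 < s \<Longrightarrow> s < s1 \<Longrightarrow> fd s softplus (Suc m) y \<ge> 0"
  shows "poly (cumulant_poly m) (logistic y) \<ge> 0"
proof (rule ccontr)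
  let ?h = "\<lambda>x. poly (cumulant_poly m) (logistic x)"
  define F where "F = (\<lambda>m. case m of 0 \<Rightarrow> softplus | Suc k \<Rightarrow> \<lambda>x. poly (cumulant_poly k) (logistic x))"
  have F: "(F k has_real_derivative F (Suc k) x) (at x)" for k x
    using softplus_iterated_deriv[of k x] unfolding F_def by simp
  assume "\<not> ?thesis"
  then have "?h y < 0" by simp
  moreover have "isCont ?h y"
    using DERIV_isCont[OF F[of "Suc m" y]] by (simp add: F_def)
  ultimately have "eventually (\<lambda>x. ?h x < 0) (at y)"
    unfolding isCont_def by (rule order_tendstoD(2)[rotated])
  then obtain d where d: "d > 0" "\<And>x. x \<noteq> y \<Longrightarrow> dist x y < d \<Longrightarrow> ?h x < 0"
    unfolding eventually_at by auto
  \<comment> \<open>Small enough for the intermediate point to stay within distance \<open>d\<close>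
    of \<open>y\<close>.\<close>
  define s where "s = min (s1 / 2) (d / (2 * real (Suc m)))"
  have s: "s > 0" "s < s1" using assms(1) d(1) by (auto simp: s_def)
  have "real (Suc m) * s \<le> real (Suc m) * (d / (2 * real (Suc m)))"
    by (intro mult_left_mono) (auto simp: s_def)
  also have "\<dots> = d / 2" by (simp add: field_simps del: of_nat_Suc)
  finally have ms: "real (Suc m) * s < d" using d(1) by simp
  obtain \<xi> where \<xi>: "\<xi> \<in> {y..y + real (Suc m) * s}" "fd s (F 0) (Suc m) y = s ^ Suc m * F (Suc m) \<xi>"
    using fd_mean_value[where F = F and m = "Suc m" and x = y, OF s(1) F] by blast
  have "?h \<xi> < 0" using d(2)[of \<xi>] \<xi>(1) ms \<open>?h y < 0\<close> by (cases "\<xi> = y") (auto simp: dist_real_def)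
  then have "fd s softplus (Suc m) y < 0"
    using \<xi>(2) s(1) by (simp add: F_def mult_pos_neg)
  with assms(2)[OF s] show False by simp
qed

lemma logistic_strict_mono: "x < y \<Longrightarrow> logistic x < logistic y"
  unfolding logistic_def by (simp add: divide_simps algebra_simps)

text \<open>If all differences were nonnegative, halving the step would make them strictly positive,
  which leaves room to move from \<open>x\<close> to some \<open>x' > x\<close>. Letting the step
  shrink further, the \<open>n\<close>-th derivative is nonnegative everywhere left of
  \<open>x'\<close>. But it vanishes at the point \<open>x0 \<le> x\<close> with
  \<open>logistic x0 = \<rho>\<close>, so it has an interior minimum there and \<rho> is a double
  root. The room is what covers the case of equality in
  \<open>\<rho> \<le> logistic x\<close>.\<close>

lemma fd_softplus_exists_neg:
  assumes s: "s > 0" and n: "n \<ge> 3" and root: "poly (cumulant_poly (n - 1)) \<rho> = 0"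
    and \<rho>: "0 < \<rho>" "\<rho> \<le> logistic x"
  shows "\<exists>m\<in>{2..n}. fd s softplus m x < 0"
proof (rule ccontr)
  assume "\<not> ?thesis"
  then have "\<forall>m\<in>{2..n}. \<not> fd s softplus m x < 0" by blast
  then have nn: "\<And>m. m \<in> {2..n} \<Longrightarrow> fd s softplus m x \<ge> 0" by (simp add: not_less)
  have pos: "fd (s / 2) softplus m x > 0" if "m \<in> {2..n}" for m
    using fd_softplus_pos_smaller_step[OF s n nn, of "s / 2" m] s that by simp
  have "\<exists>x'>x. \<forall>m\<in>{2..n}. fd (s / 2) softplus m x' \<ge> 0"
  proof -
    have "eventually (\<lambda>x'. fd (s / 2) softplus m x' > 0) (at_right x)" if "m \<in> {2..n}" for m
    proof -
      have "isCont (fd (s / 2) softplus m) x" by (rule DERIV_isCont[OF fd_softplus_deriv])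
      then have "(fd (s / 2) softplus m \<longlongrightarrow> fd (s / 2) softplus m x) (at_right x)"
        unfolding isCont_def by (rule filterlim_mono) (auto simp: at_le)
      then show ?thesis using pos[OF that] by (rule order_tendstoD(1))
    qed
    then have "eventually (\<lambda>x'. \<forall>m\<in>{2..n}. fd (s / 2) softplus m x' > 0) (at_right x)"
      by (intro eventually_ball_finite) auto
    then have "eventually (\<lambda>x'. x' > x \<and> (\<forall>m\<in>{2..n}. fd (s / 2) softplus m x' > 0)) (at_right x)"
      by (rule eventually_conj[OF eventually_at_right_less])
    from eventually_happens[OF this] show ?thesis by (auto intro: less_imp_le)
  qed
  then obtain x' where x': "x' > x" "\<And>m. m \<in> {2..n} \<Longrightarrow> fd (s / 2) softplus m x' \<ge> 0" by blast
  have K: "poly (cumulant_poly (n - 1)) (logistic y) \<ge> 0" if "y < x'" for y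
  proof (rule cumulant_nonneg_of_fd[of "s / 2"])
    fix t assume t: "0 < t" "t < s / 2"
    have "fd t softplus m x' > 0" if "m \<in> {2..n}" for m
      using fd_softplus_pos_smaller_step[OF _ n x'(2) t that] s by simp
    then have "fd t softplus n y > 0"
      using fd_softplus_nonneg_imp(1)[OF t(1) n, of x' y n] that n by (simp add: less_imp_le)
    then show "fd t softplus (Suc (n - 1)) y \<ge> 0" using n by (simp add: Suc_diff_Suc)
  qed (use s in simp)
  \<comment> \<open>The logit of \<rho>, the inverse of \<open>logistic\<close>.\<close>
  define x0 where "x0 = ln (\<rho> / (1 - \<rho>))"
  have "\<rho> < 1" using \<rho>(2) by (smt (verit) divide_less_eq_1 exp_gt_zero logistic_def)
  have "logistic x0 = \<rho>" using \<rho>(1) \<open>\<rho> < 1\<close> by (simp add: x0_def logistic_def field_simps)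
  then have "x0 \<le> x" using \<rho>(2) logistic_strict_mono[of x x0] by force
  let ?h = "\<lambda>y. poly (cumulant_poly (n - 1)) (logistic y)"
  have d: "(?h has_real_derivative poly (pderiv (cumulant_poly (n - 1))) (logistic x0)
      * (logistic x0 * (1 - logistic x0))) (at x0)"
    by (rule DERIV_chain2[OF poly_DERIV logistic_has_real_derivative])
  have "poly (pderiv (cumulant_poly (n - 1))) (logistic x0) * (logistic x0 * (1 - logistic x0)) = 0"
  proof (rule DERIV_local_min[OF d])
    show "0 < x' - x0" using x'(1) \<open>x0 \<le> x\<close> by simp
    show "\<forall>y. \<bar>x0 - y\<bar> < x' - x0 \<longrightarrow> ?h x0 \<le> ?h y"
      using K root \<open>logistic x0 = \<rho>\<close> by auto
  qed
  then have "poly (pderiv (cumulant_poly (n - 1))) \<rho> = 0"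
    using \<open>logistic x0 = \<rho>\<close> \<rho> \<open>\<rho> < 1\<close> by simp
  moreover have "n - 1 = Suc (n - 2)" using n by simp
  ultimately show False using cumulant_poly_simple_root[of "n - 2" \<rho>] root by metis
qed

section \<open>Avoidance probabilities of Poisson processes\<close>

definition hitting :: "'s::countable set \<Rightarrow> ('s \<Rightarrow> bool) set" where
  "hitting K = {b. b \<noteq> (\<lambda>_. False) \<and> (\<exists>i\<in>K. b i)}"

lemma borel_measurable_apply: "(\<lambda>b::'s::countable \<Rightarrow> bool. b i) \<in> borel_measurable borel"
  by (intro borel_measurable_continuous_onI continuous_on_product_coordinates)

lemma sets_coordinate: "{b::'s::countable \<Rightarrow> bool. b i} \<in> sets borel"
proof -
  have "(\<lambda>b::'s \<Rightarrow> bool. b i) -` {True} \<inter> space borel \<in> sets borel"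
    by (rule measurable_sets[OF borel_measurable_apply]) auto
  then show ?thesis by (simp add: vimage_def)
qed

lemma sets_hitting:
  assumes "finite K"
  shows "hitting K \<in> sets nonempty_subsets"
proof -
  have "hitting K = {b. b \<noteq> (\<lambda>_. False)} \<inter> (\<Union>i\<in>K. {b. b i})" by (auto simp: hitting_def)
  moreover have "(\<Union>i\<in>K. {b. b i}) \<in> sets borel"
    using assms sets_coordinate by (intro sets.finite_UN) auto
  ultimately show ?thesis unfolding nonempty_subsets_def sets_restrict_space by auto
qed

lemma space_nonempty_subsets: "space nonempty_subsets = {b. b \<noteq> (\<lambda>_. False)}"
  by (simp add: nonempty_subsets_def space_restrict_space)

lemma point_count_eq_0_iff: "point_count I B A = 0 \<longleftrightarrow> (\<forall>j\<in>I. B j \<notin> A)"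
  by (auto simp: point_count_def emeasure_count_space_eq_0)

text \<open>
  The push-forward along a non-measurable map is the zero measure when it fails to be a measure.
\<close>

lemma measure_distr_nonzero:
  assumes "emeasure (distr M N f) (space N) \<noteq> 0" "A \<in> sets N"
  shows "measure (distr M N f) A = measure M (f -` A \<inter> space M)"
proof -
  have ss: "sigma_sets (space N) (sets N) = sets N" by (rule sets.sigma_sets_eq)
  have *: "emeasure (distr M N f) B = (if B \<in> sets N \<and> measure_space (space N) (sets N)
      (\<lambda>A. emeasure M (f -` A \<inter> space M)) then emeasure M (f -` B \<inter> space M) else 0)" for B
    unfolding distr_def emeasure_measure_of_conv ss ..
  have "measure_space (space N) (sets N) (\<lambda>A. emeasure M (f -` A \<inter> space M))"
    using assms(1) unfolding * by (auto split: if_splits)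
  then show ?thesis using assms(2) unfolding measure_def * by simp
qed

text \<open>The process vanishes on \<open>K\<close> exactly when no Poisson point lies in
  \<open>hitting K\<close>, so the formula is the void probability.\<close>

lemma in_R_avoidance_prob:
  fixes X :: "'w \<Rightarrow> 's::countable \<Rightarrow> bool"
  assumes "in_R M X"
  shows "\<exists>\<nu>. sets \<nu> = sets nonempty_subsets \<and>
    (\<forall>K. finite K \<longrightarrow> measure M {\<omega> \<in> space M. \<forall>i\<in>K. \<not> X \<omega> i} \<noteq> 0 \<longrightarrow>
       emeasure \<nu> (hitting K) < \<infinity> \<and>
       measure M {\<omega> \<in> space M. \<forall>i\<in>K. \<not> X \<omega> i} = exp (- measure \<nu> (hitting K)))"
proof -
  obtain \<nu> and P :: "(nat set \<times> (nat \<Rightarrow> 's \<Rightarrow> bool)) measure" and I B where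
    sets: "sets \<nu> = sets nonempty_subsets" and P: "poisson_process P \<nu> I B"
    and eq: "distr M borel X = distr P borel (union_process I B)"
    using assms unfolding in_R_def by auto
  have X: "X \<in> borel_measurable M" using assms unfolding in_R_def by auto
  have sp: "\<And>\<omega> j. \<omega> \<in> space P \<Longrightarrow> j \<in> I \<omega> \<Longrightarrow> B \<omega> j \<noteq> (\<lambda>_. False)"
    using P sets_eq_imp_space_eq[OF sets] unfolding poisson_process_def space_nonempty_subsets by auto
  interpret P: prob_space P using P unfolding poisson_process_def by auto
  interpret D: prob_space "distr M borel X"
    using assms X unfolding in_R_def by (auto intro: prob_space.prob_space_distr)
  \<comment> \<open>Equality with the law of \<open>X\<close> makes the push-forward of
    \<open>union_process I B\<close> a probability measure, so its values are those of the preimages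
    although \<open>in_R\<close> does not state measurability.\<close>
  have nonzero: "emeasure (distr P borel (union_process I B)) (space borel) \<noteq> 0"
    using D.emeasure_space_1 unfolding eq[symmetric] by simp
  have main: "emeasure \<nu> (hitting K) < \<infinity> \<and>
       measure M {\<omega> \<in> space M. \<forall>i\<in>K. \<not> X \<omega> i} = exp (- measure \<nu> (hitting K))"
    if K: "finite K" and nz: "measure M {\<omega> \<in> space M. \<forall>i\<in>K. \<not> X \<omega> i} \<noteq> 0" for K
  proof -
    let ?Z = "{b. \<forall>i\<in>K. \<not> b i}" and ?c = "\<lambda>\<omega>. point_count (I \<omega>) (B \<omega>) (hitting K)"
    have hs: "hitting K \<in> sets \<nu>" using sets_hitting[OF K] sets by simp
    have "?Z = - (\<Union>i\<in>K. {b. b i})" by auto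
    moreover have "(\<Union>i\<in>K. {b. b i}) \<in> sets borel"
      using K sets_coordinate by (intro sets.finite_UN) auto
    ultimately have Z: "?Z \<in> sets borel" by (metis borel_comp)
    have "measure M {\<omega> \<in> space M. \<forall>i\<in>K. \<not> X \<omega> i} = measure (distr M borel X) ?Z"
      by (subst measure_distr[OF X Z]) (auto intro!: arg_cong[where f = "measure M"])
    also have "\<dots> = measure P {\<omega> \<in> space P. ?c \<omega> = of_nat 0}"
      unfolding eq measure_distr_nonzero[OF nonzero Z]
      using sp by (intro arg_cong[where f = "measure P"])
        (fastforce simp: point_count_eq_0_iff hitting_def union_process_def)
    finally have m: "measure M {\<omega> \<in> space M. \<forall>i\<in>K. \<not> X \<omega> i} = measure P {\<omega> \<in> space P. ?c \<omega> = of_nat 0}" .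
    show ?thesis
    proof (cases "emeasure \<nu> (hitting K) = \<infinity>")
      \<comment> \<open>Infinite intensity would give infinitely many hits almost surely, hence void
        probability 0, against \<open>nz\<close>.\<close>
      case True
      then have ae: "AE \<omega> in P. ?c \<omega> = \<infinity>"
        using P hs unfolding poisson_process_def by auto
      have "measure P {\<omega> \<in> space P. ?c \<omega> = of_nat 0} = measure P {}"
      proof (rule P.finite_measure_eq_AE)
        show "AE \<omega> in P. (\<omega> \<in> {\<omega> \<in> space P. ?c \<omega> = of_nat 0}) = (\<omega> \<in> {})"
          using ae by eventually_elim auto
        have "?c \<in> borel_measurable P" using P hs unfolding poisson_process_def by auto
        then show "{\<omega> \<in> space P. ?c \<omega> = of_nat 0} \<in> P.events" by measurable
      qed simp
      then show ?thesis using m nz by simp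
    next
      case False
      then have fin: "emeasure \<nu> (hitting K) < \<infinity>" by (simp add: less_top)
      then have "measure P {\<omega> \<in> space P. ?c \<omega> = of_nat 0}
          = exp (- measure \<nu> (hitting K)) * measure \<nu> (hitting K) ^ 0 / fact 0"
        using P hs unfolding poisson_process_def by blast
      then show ?thesis using m fin by simp
    qed
  qed
  show ?thesis using sets main by blast
qed

text \<open>Inclusion-exclusion as an induction: the sets covering \<open>insert x N'\<close> and
  avoiding \<open>D \<union> C\<close> are those covering \<open>N'\<close>, minus those that in
  addition avoid \<open>x\<close>. Enlarging \<open>C\<close> by one site lowers the argument of
  softplus by \<open>s\<close>, so each new site is one more forward difference. The affine part
  leaves \<open>c1\<close> in the first order and nothing later.\<close>

lemma covering_measure_eq:
  fixes N D :: "'s::countable set" and s x0 c0 c1 :: real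
  assumes sets: "sets \<nu> = sets nonempty_subsets" and fin: "finite N" "finite D"
    and fm: "\<And>K. finite K \<Longrightarrow> K \<subseteq> D \<union> N \<Longrightarrow> emeasure \<nu> (hitting K) < \<infinity>"
    and L: "\<And>C. C \<subseteq> N \<Longrightarrow> measure \<nu> (hitting (D \<union> C)) =
          c0 + c1 * real (card C) - softplus (x0 + (real (card N) - real (card C)) * s)"
    and N': "finite N'" "N' \<noteq> {}" and C: "N' \<union> C \<subseteq> N" "N' \<inter> C = {}"
  shows "measure \<nu> {b \<in> space \<nu>. (\<forall>i\<in>N'. b i) \<and> (\<forall>i\<in>D \<union> C. \<not> b i)} =
     fd s softplus (card N') (x0 + (real (card N) - real (card C) - real (card N')) * s)
     + (if card N' = 1 then c1 else 0)"
  using N' C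
proof (induction N' arbitrary: C rule: finite_ne_induct)
  case (singleton x)
  have finC: "finite C" "C \<subseteq> N" "x \<in> N" "x \<notin> C" using singleton fin finite_subset by auto
  let ?U = "{b \<in> space \<nu>. (\<forall>i\<in>{x}. b i) \<and> (\<forall>i\<in>D \<union> C. \<not> b i)}"
  have sp: "space \<nu> = {b. b \<noteq> (\<lambda>_. False)}"
    using sets_eq_imp_space_eq[OF sets] by (simp add: space_nonempty_subsets)
  have U: "?U = hitting (D \<union> insert x C) - hitting (D \<union> C)"
    unfolding sp hitting_def by auto
  have "measure \<nu> ?U = measure \<nu> (hitting (D \<union> insert x C)) - measure \<nu> (hitting (D \<union> C))"
    unfolding U
  proof (rule measure_Diff)
    show "emeasure \<nu> (hitting (D \<union> insert x C)) \<noteq> \<infinity>"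
    proof -
      have "D \<union> insert x C \<subseteq> D \<union> N" using finC by blast
      then show ?thesis using fm[of "D \<union> insert x C"] finC fin by (simp add: less_top)
    qed
    show "hitting (D \<union> insert x C) \<in> sets \<nu>" "hitting (D \<union> C) \<in> sets \<nu>"
      using finC fin by (auto simp: sets intro!: sets_hitting)
    show "hitting (D \<union> C) \<subseteq> hitting (D \<union> insert x C)" by (auto simp: hitting_def)
  qed
  also have "\<dots> = c1 + softplus (x0 + (real (card N) - real (card C)) * s)
      - softplus (x0 + (real (card N) - real (card C) - 1) * s)"
    using L[of C] L[of "insert x C"] finC by (simp add: algebra_simps)
  finally show ?case by (simp add: fd.simps(2) algebra_simps)
next
  case (insert x N')
  have finC: "finite C" "C \<subseteq> N" "x \<in> N" "x \<notin> C" using insert fin finite_subset by auto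
  obtain y where y: "y \<in> N'" using insert by auto
  let ?U = "\<lambda>N' C. {b \<in> space \<nu>. (\<forall>i\<in>N'. b i) \<and> (\<forall>i\<in>D \<union> C. \<not> b i)}"
  have sp: "space \<nu> = {b. b \<noteq> (\<lambda>_. False)}"
    using sets_eq_imp_space_eq[OF sets] by (simp add: space_nonempty_subsets)
  have cs: "{b \<in> space \<nu>. b i} \<in> sets \<nu>" for i
  proof -
    have "{b \<in> space \<nu>. b i} = hitting {i}" unfolding sp hitting_def by auto
    then show ?thesis using sets_hitting[of "{i}"] sets by simp
  qed
  have Us: "?U A C \<in> sets \<nu>" if "finite A" "finite C" for A C
    using that fin cs by (intro sets.sets_Collect_conj sets.sets_Collect_finite_All' sets.sets_Collect_neg
      sets.sets_Collect_finite_All) auto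
  have U: "?U (insert x N') C = ?U N' C - ?U N' (insert x C)" by auto
  have "measure \<nu> (?U (insert x N') C) = measure \<nu> (?U N' C) - measure \<nu> (?U N' (insert x C))"
    unfolding U
  proof (rule measure_Diff)
    \<comment> \<open>Finite measure, as all these sets contain \<open>y\<close>.\<close>
    have "?U N' C \<subseteq> hitting {y}" using y unfolding sp hitting_def by auto
    then have "emeasure \<nu> (?U N' C) \<le> emeasure \<nu> (hitting {y})"
      using sets_hitting[of "{y}"] sets by (intro emeasure_mono) auto
    moreover have "emeasure \<nu> (hitting {y}) < \<infinity>" using y insert by (intro fm) auto
    ultimately show "emeasure \<nu> (?U N' C) \<noteq> \<infinity>" by auto
    show "?U N' C \<in> sets \<nu>" by (rule Us) (use insert.hyps finC in auto)
    show "?U N' (insert x C) \<in> sets \<nu>" by (rule Us) (use insert.hyps finC in auto)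
    show "?U N' (insert x C) \<subseteq> ?U N' C" by auto
  qed
  also have "measure \<nu> (?U N' C) = fd s softplus (card N') (x0 + (real (card N) - real (card C) - real (card N')) * s)
     + (if card N' = 1 then c1 else 0)"
    using insert.prems insert.hyps by (intro insert.IH) auto
  also have "measure \<nu> (?U N' (insert x C)) =
     fd s softplus (card N') (x0 + (real (card N) - real (card (insert x C)) - real (card N')) * s)
     + (if card N' = 1 then c1 else 0)"
    using insert.prems insert.hyps by (intro insert.IH) auto
  finally have "measure \<nu> (?U (insert x N') C) =
     fd s softplus (card N') (x0 + (real (card N) - real (card C) - real (card N')) * s)
     - fd s softplus (card N') (x0 + (real (card N) - real (card (insert x C)) - real (card N')) * s)"
    by simp
  moreover have "card (insert x N') \<noteq> 1" using insert.hyps y by (auto simp: card_gt_0_iff)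
  moreover have "card (insert x N') = Suc (card N')" using insert.hyps by simp
  moreover have "card (insert x C) = Suc (card C)" using finC by simp
  ultimately show ?case by (simp add: fd.simps(2) algebra_simps)
qed

section \<open>The Ising model on a star\<close>

definition nb :: "int ^ 'd::finite \<Rightarrow> (int ^ 'd) set" where
  "nb x = {y. neighbours x y}"

lemma neighbours_iff_axis:
  "neighbours x y \<longleftrightarrow> (\<exists>k. \<exists>e\<in>{-1, 1}. y = x + axis k e)"
proof
  assume "neighbours x y"
  then have sum1: "(\<Sum>k\<in>UNIV. \<bar>x $ k - y $ k\<bar>) = 1" by (simp add: neighbours_def)
  then obtain k where k: "x $ k - y $ k \<noteq> 0"
    by (metis (no_types, lifting) abs_0 sum.neutral zero_neq_one)
  have split: "(\<Sum>j\<in>UNIV. \<bar>x $ j - y $ j\<bar>) = \<bar>x $ k - y $ k\<bar> + (\<Sum>j\<in>UNIV - {k}. \<bar>x $ j - y $ j\<bar>)"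
    by (rule sum.remove) auto
  moreover have nonneg: "(\<Sum>j\<in>UNIV - {k}. \<bar>x $ j - y $ j\<bar>) \<ge> 0" by (rule sum_nonneg) simp
  ultimately have e: "\<bar>x $ k - y $ k\<bar> = 1" "(\<Sum>j\<in>UNIV - {k}. \<bar>x $ j - y $ j\<bar>) = 0"
    using sum1 k by linarith+
  then have others: "x $ j = y $ j" if "j \<noteq> k" for j
    using that sum_nonneg_eq_0_iff[of "UNIV - {k}" "\<lambda>j. \<bar>x $ j - y $ j\<bar>"] by auto
  have "y = x + axis k (y $ k - x $ k)"
    using others by (auto simp: vec_eq_iff axis_def)
  moreover have "y $ k - x $ k \<in> {-1, 1}" using e(1) by auto
  ultimately show "\<exists>k. \<exists>e\<in>{-1, 1}. y = x + axis k e" by blast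
next
  assume "\<exists>k. \<exists>e\<in>{-1, 1}. y = x + axis k e"
  then obtain k e where ke: "e \<in> {-1, 1}" "y = x + axis k e" by blast
  have "(\<Sum>j\<in>UNIV. \<bar>x $ j - y $ j\<bar>) = (\<Sum>j\<in>UNIV. if j = k then 1 else 0)"
    using ke by (intro sum.cong) (auto simp: axis_def)
  then show "neighbours x y" by (simp add: neighbours_def)
qed

lemma nb_eq: "nb x = (\<lambda>(k, e). x + axis k e) ` (UNIV \<times> {-1, 1})"
  unfolding nb_def neighbours_iff_axis by force

lemma finite_nb: "finite (nb x)"
  unfolding nb_eq by auto

lemma card_nb: "card (nb (x :: int ^ 'd::finite)) = 2 * CARD('d)"
proof -
  have "inj_on (\<lambda>(k, e). x + axis k e) (UNIV \<times> {-1, 1})"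
    by (rule inj_onI) (auto simp: axis_eq_axis)
  then have "card (nb x) = card ((UNIV :: 'd set) \<times> {-1, 1 :: int})"
    unfolding nb_eq by (rule card_image)
  then show ?thesis by (simp add: card_cartesian_product)
qed

lemma nb_sym: "y \<in> nb x \<longleftrightarrow> x \<in> nb y"
  by (simp add: nb_def neighbours_def abs_minus_commute)

text \<open>The lattice is bipartite: a step to a neighbour changes the coordinate sum by 1 or
  -1.\<close>

lemma nb_parity: "y \<in> nb x \<Longrightarrow> even (\<Sum>k\<in>UNIV. y $ k) \<noteq> even (\<Sum>k\<in>UNIV. x $ k)"
proof -
  assume "y \<in> nb x"
  then obtain k e where ke: "e \<in> {-1, 1}" "y = x + axis k e"
    unfolding nb_def neighbours_iff_axis by blast
  have "(\<Sum>j\<in>UNIV. y $ j) = (\<Sum>j\<in>UNIV. x $ j) + (\<Sum>j\<in>UNIV. if j = k then e else 0)"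
    unfolding ke(2) by (simp add: sum.distrib axis_def)
  then show ?thesis using ke(1) by auto
qed

lemma ising_weight_singleton:
  "ising_weight J {x} \<sigma> = exp (J * (real_of_int (\<sigma> x) * (\<Sum>y\<in>nb x. real_of_int (\<sigma> y))))"
proof -
  have x: "x \<notin> nb x" using nb_parity[of x x] by blast
  have "{e \<in> nn_pairs. e \<inter> {x} \<noteq> {}} = (\<lambda>y. {x, y}) ` nb x"
    by (auto simp: nn_pairs_def nb_def neighbours_def abs_minus_commute)
  moreover have "inj_on (\<lambda>y. {x, y}) (nb x)"
    by (rule inj_onI) (auto simp: doubleton_eq_iff)
  moreover have "(\<Prod>i\<in>{x, y}. real_of_int (\<sigma> i)) = real_of_int (\<sigma> x) * real_of_int (\<sigma> y)"
    if "y \<in> nb x" for y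
    using that x by (subst prod.insert) auto
  ultimately have "(\<Sum>e\<in>{e \<in> nn_pairs. e \<inter> {x} \<noteq> {}}. \<Prod>i\<in>e. real_of_int (\<sigma> i))
      = real_of_int (\<sigma> x) * (\<Sum>y\<in>nb x. real_of_int (\<sigma> y))"
    by (simp add: sum.reindex sum_distrib_left)
  then show ?thesis by (simp only: ising_weight_def)
qed

text \<open>The heat-bath probability of spin \<open>e\<close> at \<open>x\<close>, that is, the
  quotient of the single-site weights written in logistic form.\<close>

definition spin_prob :: "real \<Rightarrow> int ^ 'd::finite \<Rightarrow> int \<Rightarrow> (int ^ 'd \<Rightarrow> int) \<Rightarrow> real" where
  "spin_prob J x e \<sigma> = 1 / (1 + exp (- 2 * J * real_of_int e * (\<Sum>y\<in>nb x. real_of_int (\<sigma> y))))"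

lemma ising_kernel_singleton:
  assumes "e \<in> {-1, 1}"
  shows "ising_kernel J {x} \<sigma> (restrict (\<lambda>_. e) {x}) = spin_prob J x e \<sigma>"
proof -
  define S where "S = (\<Sum>y\<in>nb x. real_of_int (\<sigma> y))"
  have x: "x \<notin> nb x" using nb_parity[of x x] by blast
  have w: "ising_weight J {x} (override_on \<sigma> (restrict (\<lambda>_. v) {x}) {x}) = exp (J * (real_of_int v * S))" for v
  proof -
    have "(\<Sum>y\<in>nb x. real_of_int (override_on \<sigma> (restrict (\<lambda>_. v) {x}) {x} y)) = S"
      unfolding S_def using x by (intro sum.cong) (auto simp: override_on_def)
    then show ?thesis unfolding ising_weight_singleton by (simp add: override_on_def)
  qed
  have PiE: "{x} \<rightarrow>\<^sub>E {-1, 1 :: int} = {restrict (\<lambda>_. -1) {x}, restrict (\<lambda>_. 1) {x}}" (is "?L = ?R")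
  proof (intro equalityI subsetI)
    fix \<zeta> assume "\<zeta> \<in> ?L"
    then have "\<zeta> x \<in> {-1, 1}" "\<zeta> = restrict (\<lambda>_. \<zeta> x) {x}"
      by (auto simp: PiE_iff extensional_def)
    then show "\<zeta> \<in> ?R" by (metis insertE insertI1 insertI2 singletonD)
  qed (auto simp: PiE_iff extensional_def split: if_splits)
  have "restrict (\<lambda>_. -1 :: int) {x} \<noteq> restrict (\<lambda>_. 1) {x}"
    by (metis one_neq_neg_one restrict_apply' singletonI)
  then have "(\<Sum>\<zeta>\<in>{x} \<rightarrow>\<^sub>E {-1, 1}. ising_weight J {x} (override_on \<sigma> \<zeta> {x})) = exp (- (J * S)) + exp (J * S)"
    unfolding PiE by (simp add: w)
  then have "ising_kernel J {x} \<sigma> (restrict (\<lambda>_. e) {x}) = exp (J * (real_of_int e * S)) / (exp (- (J * S)) + exp (J * S))"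
    unfolding ising_kernel_def w by simp
  also have "\<dots> = 1 / (1 + exp (- 2 * J * real_of_int e * S))"
  proof -
    have "exp (- (J * S)) + exp (J * S) = exp (J * (real_of_int e * S)) * (1 + exp (- 2 * J * real_of_int e * S))"
      using assms by (auto simp: distrib_left mult_exp_exp)
    then show ?thesis by simp
  qed
  finally show ?thesis unfolding S_def spin_prob_def .
qed

section \<open>Cylinder events and single-site conditioning\<close>

lemma sets_spins_cylinder:
  assumes "finite K" "K \<subseteq> \<Lambda>" "\<And>i. i \<in> K \<Longrightarrow> \<tau> i \<in> {-1, 1}"
  shows "{\<sigma> \<in> space (spins \<Lambda>). \<forall>i\<in>K. \<sigma> i = \<tau> i} \<in> sets (spins \<Lambda>)"
proof (rule sets.sets_Collect_finite_All)
  fix i assume i: "i \<in> K"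
  have "(\<lambda>\<sigma>. \<sigma> i) \<in> spins \<Lambda> \<rightarrow>\<^sub>M count_space {-1, 1}"
    unfolding spins_def using i assms(2) by (intro measurable_component_singleton) auto
  from measurable_sets[OF this, of "{\<tau> i}"] assms(3)[OF i]
  have "(\<lambda>\<sigma>. \<sigma> i) -` {\<tau> i} \<inter> space (spins \<Lambda>) \<in> sets (spins \<Lambda>)" by auto
  moreover have "(\<lambda>\<sigma>. \<sigma> i) -` {\<tau> i} \<inter> space (spins \<Lambda>) = {\<sigma> \<in> space (spins \<Lambda>). \<sigma> i = \<tau> i}" by auto
  ultimately show "{\<sigma> \<in> space (spins \<Lambda>). \<sigma> i = \<tau> i} \<in> sets (spins \<Lambda>)" by simp
qed (rule assms(1))

lemma measurable_restrict_spins: "(\<lambda>\<sigma>. restrict \<sigma> (- \<Lambda>)) \<in> spins UNIV \<rightarrow>\<^sub>M spins (- \<Lambda>)"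
  unfolding spins_def by (rule measurable_restrict_subset) simp

lemma sets_outside_cylinder:
  assumes "finite K" "K \<inter> \<Lambda> = {}" "\<And>i. i \<in> K \<Longrightarrow> \<tau> i \<in> {-1, 1}"
  shows "{\<sigma> \<in> space (spins UNIV). \<forall>i\<in>K. \<sigma> i = \<tau> i} \<in> sets (outside_algebra \<Lambda>)"
proof -
  let ?A = "{\<sigma> \<in> space (spins (- \<Lambda>)). \<forall>i\<in>K. \<sigma> i = \<tau> i}"
  have r: "(\<lambda>\<sigma>. restrict \<sigma> (- \<Lambda>)) \<in> space (spins UNIV) \<rightarrow> space (spins (- \<Lambda>))"
    using measurable_restrict_spins by (rule measurable_space[THEN Pi_I])
  have "?A \<in> sets (spins (- \<Lambda>))"
    using assms by (intro sets_spins_cylinder) auto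
  then have "(\<lambda>\<sigma>. restrict \<sigma> (- \<Lambda>)) -` ?A \<inter> space (spins UNIV) \<in> sets (outside_algebra \<Lambda>)"
    unfolding outside_algebra_def sets_vimage_algebra2[OF r] by blast
  moreover have "(\<lambda>\<sigma>. restrict \<sigma> (- \<Lambda>)) -` ?A \<inter> space (spins UNIV)
      = {\<sigma> \<in> space (spins UNIV). \<forall>i\<in>K. \<sigma> i = \<tau> i}"
    using assms(2) r by (auto simp: restrict_def Pi_iff)
  ultimately show ?thesis by simp
qed

locale ising =
  fixes J :: real and \<mu> :: "(int ^ 'd::finite \<Rightarrow> int) measure"
  assumes J: "J > 0" and gibbs: "ising_gibbs J \<mu>"
begin

sublocale prob_space \<mu> using gibbs unfolding ising_gibbs_def by simp

lemma sets_\<mu>: "sets \<mu> = sets (spins UNIV)"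
  using gibbs unfolding ising_gibbs_def by simp

lemma space_\<mu>: "space \<mu> = space (spins UNIV)"
  by (rule sets_eq_imp_space_eq[OF sets_\<mu>])

definition cyl :: "(int ^ 'd) set \<Rightarrow> (int ^ 'd \<Rightarrow> int) \<Rightarrow> (int ^ 'd \<Rightarrow> int) set" where
  "cyl K \<tau> = {\<sigma> \<in> space (spins UNIV). \<forall>i\<in>K. \<sigma> i = \<tau> i}"

lemma spin_range: "\<sigma> \<in> space (spins UNIV) \<Longrightarrow> \<sigma> i \<in> {-1, 1}"
  unfolding spins_def space_PiM by (auto simp: PiE_iff)

lemma subalgebra: "subalgebra \<mu> (outside_algebra \<Lambda>)"
proof -
  have r: "(\<lambda>\<sigma>. restrict \<sigma> (- \<Lambda>)) \<in> space (spins UNIV) \<rightarrow> space (spins (- \<Lambda>))"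
    using measurable_restrict_spins by (rule measurable_space[THEN Pi_I])
  show ?thesis
    unfolding subalgebra_def space_\<mu> sets_\<mu> outside_algebra_def sets_vimage_algebra2[OF r]
    using measurable_sets[OF measurable_restrict_spins] by auto
qed

lemma cyl_sets:
  assumes "finite K" "\<And>i. i \<in> K \<Longrightarrow> \<tau> i \<in> {-1, 1}"
  shows "cyl K \<tau> \<in> sets \<mu>"
  unfolding cyl_def sets_\<mu> using assms by (intro sets_spins_cylinder) auto

text \<open>The cylinder over \<open>K\<close> belongs to the outside algebra of \<open>x\<close>,
  so integrating the conditional probability of the spin at \<open>x\<close> over it gives the
  larger cylinder. \<open>h\<close> is this conditional expectation, whose integrability is
  known.\<close>

lemma single_site:
  assumes K: "finite K" "x \<notin> K" and \<tau>: "\<And>i. i \<in> insert x K \<Longrightarrow> \<tau> i \<in> {-1, 1}"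
  obtains h where "integrable \<mu> h" "AE \<sigma> in \<mu>. h \<sigma> = spin_prob J x (\<tau> x) \<sigma>"
    "measure \<mu> (cyl (insert x K) \<tau>) = (\<integral>\<sigma>\<in>cyl K \<tau>. h \<sigma> \<partial>\<mu>)"
proof -
  let ?F = "outside_algebra {x}" and ?\<eta> = "restrict (\<lambda>_. \<tau> x) {x}"
  let ?f = "indicat_real {\<sigma>. \<forall>i\<in>{x}. \<sigma> i = ?\<eta> i}"
  interpret finite_measure_subalgebra \<mu> ?F
    by unfold_locales (rule subalgebra)
  have cx: "cyl {x} \<tau> \<in> sets \<mu>" using \<tau> by (intro cyl_sets) auto
  have fi: "?f \<sigma> = indicat_real (cyl {x} \<tau>) \<sigma>" if "\<sigma> \<in> space \<mu>" for \<sigma>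
    using that by (simp add: cyl_def space_\<mu> indicator_def)
  have int: "integrable \<mu> ?f"
    using cx by (subst Bochner_Integration.integrable_cong[OF refl fi])
      (auto intro!: integrable_real_indicator simp: less_top[symmetric])
  have E: "cyl K \<tau> \<in> sets ?F"
    unfolding cyl_def using K \<tau> by (intro sets_outside_cylinder) auto
  have EM: "cyl K \<tau> \<in> sets \<mu>" using K \<tau> by (intro cyl_sets) auto
  have "measure \<mu> (cyl (insert x K) \<tau>) = (\<integral>\<sigma>. indicat_real (cyl (insert x K) \<tau>) \<sigma> \<partial>\<mu>)"
    using K \<tau> by (subst Bochner_Integration.integral_indicator) (auto simp: cyl_def space_\<mu> Int_absorb2)
  also have "\<dots> = (\<integral>\<sigma>\<in>cyl K \<tau>. ?f \<sigma> \<partial>\<mu>)"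
    unfolding set_lebesgue_integral_def
    by (intro Bochner_Integration.integral_cong) (auto simp: cyl_def indicator_def)
  also have "\<dots> = (\<integral>\<sigma>\<in>cyl K \<tau>. real_cond_exp \<mu> ?F ?f \<sigma> \<partial>\<mu>)"
    by (rule real_cond_exp_intA[OF int E])
  finally have eq: "measure \<mu> (cyl (insert x K) \<tau>) = (\<integral>\<sigma>\<in>cyl K \<tau>. real_cond_exp \<mu> ?F ?f \<sigma> \<partial>\<mu>)" .
  have "?\<eta> \<in> {x} \<rightarrow>\<^sub>E {-1, 1}" using \<tau> by auto
  then have "AE \<sigma> in \<mu>. real_cond_exp \<mu> ?F ?f \<sigma> = ising_kernel J {x} \<sigma> ?\<eta>"
    using gibbs unfolding ising_gibbs_def by blast
  moreover have "ising_kernel J {x} \<sigma> ?\<eta> = spin_prob J x (\<tau> x) \<sigma>" for \<sigma>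
    using \<tau> by (intro ising_kernel_singleton) auto
  ultimately have "AE \<sigma> in \<mu>. real_cond_exp \<mu> ?F ?f \<sigma> = spin_prob J x (\<tau> x) \<sigma>" by simp
  with real_cond_exp_int(1)[OF int] show ?thesis using eq by (rule that)
qed

text \<open>With all neighbours fixed, \<open>spin_prob\<close> is constant on the cylinder and
  leaves the integral; the last factor is its reciprocal.\<close>

lemma single_site_known_neighbours:
  assumes K: "finite K" "x \<notin> K" and \<tau>: "\<And>i. i \<in> insert x K \<Longrightarrow> \<tau> i \<in> {-1, 1}" and nb: "nb x \<subseteq> K"
  shows "measure \<mu> (cyl K \<tau>) = measure \<mu> (cyl (insert x K) \<tau>) *
    (1 + exp (- 2 * J * real_of_int (\<tau> x) * (\<Sum>y\<in>nb x. real_of_int (\<tau> y))))"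
proof -
  define g where "g = spin_prob J x (\<tau> x)"
  obtain h where h: "integrable \<mu> h" "AE \<sigma> in \<mu>. h \<sigma> = g \<sigma>"
    "measure \<mu> (cyl (insert x K) \<tau>) = (\<integral>\<sigma>\<in>cyl K \<tau>. h \<sigma> \<partial>\<mu>)"
    unfolding g_def by (rule single_site[OF K \<tau>])
  have EM: "cyl K \<tau> \<in> sets \<mu>" using K \<tau> by (intro cyl_sets) auto
  have g: "g \<sigma> = g \<tau>" if "\<sigma> \<in> cyl K \<tau>" for \<sigma>
  proof -
    have "(\<Sum>y\<in>nb x. real_of_int (\<sigma> y)) = (\<Sum>y\<in>nb x. real_of_int (\<tau> y))"
      using that nb by (intro sum.cong) (auto simp: cyl_def)
    then show ?thesis by (simp add: g_def spin_prob_def)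
  qed
  have "(\<integral>\<sigma>\<in>cyl K \<tau>. h \<sigma> \<partial>\<mu>) = (\<integral>\<sigma>\<in>cyl K \<tau>. g \<tau> \<partial>\<mu>)"
    using h EM g unfolding set_lebesgue_integral_def
    by (intro integral_cong_AE) (auto simp: indicator_def elim: AE_mp)
  also have "\<dots> = measure \<mu> (cyl K \<tau>) * g \<tau>"
    using EM by (simp add: set_lebesgue_integral_def)
  finally have "measure \<mu> (cyl (insert x K) \<tau>) = measure \<mu> (cyl K \<tau>) * g \<tau>" using h(3) by simp
  moreover have "1 + exp (- 2 * J * real_of_int (\<tau> x) * (\<Sum>y\<in>nb x. real_of_int (\<tau> y))) > 0"
    by (intro add_pos_pos) auto
  ultimately show ?thesis unfolding g_def spin_prob_def by simp
qed

text \<open>Finite energy: each further spin costs at most a fixed factor.\<close>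

lemma cyl_pos:
  assumes "finite K" "\<And>i. i \<in> K \<Longrightarrow> \<tau> i \<in> {-1, 1}"
  shows "measure \<mu> (cyl K \<tau>) > 0"
  using assms
proof (induction K rule: finite_induct)
  case empty
  have "cyl {} \<tau> = space \<mu>" by (simp add: cyl_def space_\<mu>)
  then show ?case using prob_space by simp
next
  case (insert x K)
  define g where "g = spin_prob J x (\<tau> x)"
  \<comment> \<open>The heat-bath probability in the worst case, with all neighbours
    opposed.\<close>
  define c where "c = 1 / (1 + exp (2 * J * real (card (nb x))))"
  have "c > 0" by (simp add: c_def add_pos_pos)
  obtain h where h: "integrable \<mu> h" "AE \<sigma> in \<mu>. h \<sigma> = g \<sigma>"
    "measure \<mu> (cyl (insert x K) \<tau>) = (\<integral>\<sigma>\<in>cyl K \<tau>. h \<sigma> \<partial>\<mu>)"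
    unfolding g_def by (rule single_site[OF insert.hyps(1,2) insert.prems])
  have EM: "cyl K \<tau> \<in> sets \<mu>" using insert by (intro cyl_sets) auto
  have gc: "g \<sigma> \<ge> c" if "\<sigma> \<in> space \<mu>" for \<sigma>
  proof -
    have \<sigma>: "\<bar>real_of_int (\<sigma> y)\<bar> \<le> 1" for y using spin_range[of \<sigma> y] that by (auto simp: space_\<mu>)
    have "\<bar>\<Sum>y\<in>nb x. real_of_int (\<sigma> y)\<bar> \<le> (\<Sum>y\<in>nb x. 1)"
      by (rule order.trans[OF sum_abs sum_mono]) (rule \<sigma>)
    then have "\<bar>\<Sum>y\<in>nb x. real_of_int (\<sigma> y)\<bar> \<le> real (card (nb x))" by simp
    moreover have "\<tau> x = -1 \<or> \<tau> x = 1" using insert.prems by auto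
    ultimately have "- (real_of_int (\<tau> x) * (\<Sum>y\<in>nb x. real_of_int (\<sigma> y))) \<le> real (card (nb x))"
      by (auto simp: abs_le_iff)
    then have "2 * J * - (real_of_int (\<tau> x) * (\<Sum>y\<in>nb x. real_of_int (\<sigma> y))) \<le> 2 * J * real (card (nb x))"
      using J by (intro mult_left_mono) auto
    then have "- 2 * J * real_of_int (\<tau> x) * (\<Sum>y\<in>nb x. real_of_int (\<sigma> y)) \<le> 2 * J * real (card (nb x))"
      by (simp add: mult.assoc)
    then show ?thesis unfolding g_def spin_prob_def c_def
      by (intro divide_left_mono add_left_mono mult_pos_pos add_pos_pos) auto
  qed
  have "0 < measure \<mu> (cyl K \<tau>) * c" using insert \<open>c > 0\<close> by simp
  also have "\<dots> = (\<integral>\<sigma>\<in>cyl K \<tau>. c \<partial>\<mu>)" using EM by (simp add: set_lebesgue_integral_def)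
  also have "\<dots> \<le> (\<integral>\<sigma>\<in>cyl K \<tau>. h \<sigma> \<partial>\<mu>)"
    unfolding set_lebesgue_integral_def
  proof (rule integral_mono_AE)
    show "integrable \<mu> (\<lambda>\<sigma>. indicat_real (cyl K \<tau>) \<sigma> *\<^sub>R c)"
      using EM by (intro integrable_mult_indicator) auto
    show "integrable \<mu> (\<lambda>\<sigma>. indicat_real (cyl K \<tau>) \<sigma> *\<^sub>R h \<sigma>)"
      using EM h(1) by (intro integrable_mult_indicator) auto
    show "AE \<sigma> in \<mu>. indicat_real (cyl K \<tau>) \<sigma> *\<^sub>R c \<le> indicat_real (cyl K \<tau>) \<sigma> *\<^sub>R h \<sigma>"
      using h(2) AE_space by eventually_elim (use gc in \<open>auto simp: indicator_def\<close>)
  qed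
  finally show ?case using h(3) by simp
qed

text \<open>Once \<open>D\<close> is fixed to -1 and the origin to a spin \<open>t\<close>, every
  site of \<open>N\<close> has all its neighbours fixed. Removing the sites of \<open>N\<close> from
  the event one by one thus contributes the same factor \<open>A t\<close> each time. Summing over
  the two values of \<open>t\<close> gives the two powers.\<close>

lemma star_prob:
  defines "n \<equiv> 2 * CARD('d)"
  shows "\<exists>D N c. finite D \<and> finite N \<and> card N = n \<and> c > 0 \<and>
    (\<forall>C\<subseteq>N. measure \<mu> (cyl (D \<union> C) (\<lambda>_. -1)) =
       c * ((1 + exp (- 2 * real n * J)) ^ (n - card C) +
            exp (- 2 * real n * J) * (1 + exp (- 2 * (real n - 2) * J)) ^ (n - card C)))"
proof -
  define N where "N = nb (0 :: int ^ 'd)"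
  define D where "D = (\<Union>x\<in>N. nb x) - {0}"
  have fin: "finite N" "finite D" by (auto simp: N_def D_def finite_nb)
  have cN: "card N = n" by (simp add: N_def n_def card_nb)
  have n: "n \<ge> 1" by (simp add: n_def Suc_leI)
  have odd: "odd (\<Sum>k\<in>UNIV. x $ k)" if "x \<in> N" for x
    using nb_parity[of x 0] that by (simp add: N_def)
  have even: "even (\<Sum>k\<in>UNIV. x $ k)" if "x \<in> D" for x
    using that odd nb_parity by (auto simp: D_def)
  \<comment> \<open>By parity: sites of \<open>N\<close> are odd, the origin and the sites of
    \<open>D\<close> are even.\<close>
  have disj: "D \<inter> N = {}" "0 \<notin> D" "0 \<notin> N"
    using odd even by (auto simp: D_def) (metis odd even_zero sum.neutral zero_index)+
  define \<tau> where "\<tau> t = (\<lambda>i::int ^ 'd. if i = 0 then t else -1 :: int)" for t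
  define ev where "ev C t = measure \<mu> (cyl (insert 0 (D \<union> C)) (\<tau> t))" for C t
  \<comment> \<open>The neighbours of a site of \<open>N\<close> are the origin and
    \<open>n - 1\<close> sites of \<open>D\<close>, with spin sum
    \<open>t - (n - 1)\<close>.\<close>
  define A where "A t = 1 + exp (2 * J * (real_of_int t - (real n - 1)))" for t
  have step: "ev C t = ev (insert x C) t * A t"
    if t: "t \<in> {-1, 1}" and x: "x \<in> N" "x \<notin> C" and C: "C \<subseteq> N" for C x t
  proof -
    have x0: "0 \<in> nb x" using x(1) nb_sym unfolding N_def by blast
    have sub: "nb x \<subseteq> insert 0 (D \<union> C)" using x(1) by (auto simp: D_def)
    have "(\<Sum>y\<in>nb x. real_of_int (\<tau> t y)) = real_of_int t + (\<Sum>y\<in>nb x - {0}. real_of_int (\<tau> t y))"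
      using x0 by (subst sum.remove[OF finite_nb x0]) (simp add: \<tau>_def)
    also have "(\<Sum>y\<in>nb x - {0}. real_of_int (\<tau> t y)) = (\<Sum>y\<in>nb x - {0}. -1)"
      by (intro sum.cong) (auto simp: \<tau>_def)
    also have "\<dots> = - (real n - 1)"
      using x0 n by (simp add: card_Diff_singleton card_nb n_def[symmetric] of_nat_diff)
    finally have S: "(\<Sum>y\<in>nb x. real_of_int (\<tau> t y)) = real_of_int t - (real n - 1)" by simp
    have "x \<noteq> 0" using x disj by auto
    then have \<tau>x: "\<tau> t x = -1" by (simp add: \<tau>_def)
    have "ev C t = measure \<mu> (cyl (insert x (insert 0 (D \<union> C))) (\<tau> t)) *
        (1 + exp (- 2 * J * real_of_int (\<tau> t x) * (\<Sum>y\<in>nb x. real_of_int (\<tau> t y))))"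
      unfolding ev_def
    proof (rule single_site_known_neighbours[OF _ _ _ sub])
      show "finite (insert 0 (D \<union> C))" using fin C finite_subset by auto
      show "x \<notin> insert 0 (D \<union> C)" using x disj \<open>x \<noteq> 0\<close> by auto
      show "\<tau> t i \<in> {-1, 1}" for i using t by (auto simp: \<tau>_def)
    qed
    also have "insert x (insert 0 (D \<union> C)) = insert 0 (D \<union> insert x C)" by auto
    finally show ?thesis unfolding S \<tau>x by (simp add: ev_def A_def)
  qed
  have evN: "ev C t = ev N t * A t ^ (n - card C)" if t: "t \<in> {-1, 1}" and C: "C \<subseteq> N" for C t
    using C
  proof (induction "n - card C" arbitrary: C)
    case 0
    then have "C = N" using fin cN by (metis card_mono card_subset_eq diff_is_0_eq le_antisym)
    then show ?case using 0 cN by simp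
  next
    case (Suc k)
    then have "C \<noteq> N" using cN by auto
    then obtain x where x: "x \<in> N" "x \<notin> C" using Suc.prems by auto
    have finC: "finite C" using Suc.prems fin finite_subset by auto
    then have ci: "card (insert x C) = Suc (card C)" using x by simp
    then have k: "k = n - card (insert x C)" using Suc(2) by simp
    have "ev C t = ev (insert x C) t * A t" using step[OF t x] Suc.prems by simp
    also have "ev (insert x C) t = ev N t * A t ^ k"
      using Suc(1)[OF k] x Suc.prems k by simp
    finally show ?case using Suc(2) by (simp flip: Suc(2))
  qed
  define p where "p = measure \<mu> (cyl (D \<union> N) (\<lambda>_. -1))"
  have center: "p = ev N t * (1 + exp (2 * J * real_of_int t * real n))" if t: "t \<in> {-1, 1}" for t
  proof -
    have "cyl (D \<union> N) (\<tau> t) = cyl (D \<union> N) (\<lambda>_. -1)"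
      using disj by (auto simp: cyl_def \<tau>_def)
    then have "p = measure \<mu> (cyl (D \<union> N) (\<tau> t))" by (simp add: p_def)
    also have "\<dots> = measure \<mu> (cyl (insert 0 (D \<union> N)) (\<tau> t)) *
        (1 + exp (- 2 * J * real_of_int (\<tau> t 0) * (\<Sum>y\<in>nb 0. real_of_int (\<tau> t y))))"
      using fin disj t by (intro single_site_known_neighbours) (auto simp: N_def \<tau>_def)
    also have "(\<Sum>y\<in>nb 0. real_of_int (\<tau> t y)) = (\<Sum>y\<in>N. -1)"
      unfolding N_def[symmetric] using disj by (intro sum.cong) (auto simp: \<tau>_def)
    finally show ?thesis using cN by (simp add: ev_def \<tau>_def)
  qed
  \<comment> \<open>\<open>center\<close> expresses the same \<open>p\<close> through either spin of
    the origin; comparing the two gives the weight of spin 1 relative to spin -1.\<close>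
  have ratio: "ev N 1 = ev N (-1) * exp (- 2 * real n * J)"
  proof -
    define E where "E = exp (2 * real n * J)"
    have "ev N 1 * (1 + E) = ev N (-1) * (1 + 1 / E)"
      using center[of 1] center[of "-1"] by (simp add: E_def exp_minus inverse_eq_divide mult_ac)
    moreover have "1 + 1 / E = (1 + E) * (1 / E)" "1 + E > 0" by (auto simp: E_def field_simps add_pos_pos)
    ultimately have "ev N 1 = ev N (-1) * (1 / E)" by (simp del: times_divide_eq_right)
    then show ?thesis by (simp add: E_def exp_minus inverse_eq_divide)
  qed
  have c: "ev N (-1) > 0"
    unfolding ev_def using fin by (intro cyl_pos) (auto simp: \<tau>_def)
  have "measure \<mu> (cyl (D \<union> C) (\<lambda>_. -1)) =
       ev N (-1) * ((1 + exp (- 2 * real n * J)) ^ (n - card C) +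
            exp (- 2 * real n * J) * (1 + exp (- 2 * (real n - 2) * J)) ^ (n - card C))" if C: "C \<subseteq> N" for C
  proof -
    have finC: "finite C" using C fin finite_subset by auto
    have "cyl (D \<union> C) (\<lambda>_. -1) = cyl (insert 0 (D \<union> C)) (\<tau> (-1)) \<union> cyl (insert 0 (D \<union> C)) (\<tau> 1)"
      using disj C spin_range by (force simp: cyl_def \<tau>_def)
    moreover have "cyl (insert 0 (D \<union> C)) (\<tau> (-1)) \<inter> cyl (insert 0 (D \<union> C)) (\<tau> 1) = {}"
      by (auto simp: cyl_def \<tau>_def)
    moreover have "cyl (insert 0 (D \<union> C)) (\<tau> t) \<in> sets \<mu>" if "t \<in> {-1, 1}" for t
      using fin finC that by (intro cyl_sets) (auto simp: \<tau>_def)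
    ultimately have "measure \<mu> (cyl (D \<union> C) (\<lambda>_. -1)) = ev C (-1) + ev C 1"
      unfolding ev_def by (simp add: finite_measure_Union)
    also have "\<dots> = ev N (-1) * A (-1) ^ (n - card C) + ev N (-1) * exp (- 2 * real n * J) * A 1 ^ (n - card C)"
      using evN[OF _ C, of "-1"] evN[OF _ C, of 1] ratio by simp
    also have "A (-1) = 1 + exp (- 2 * real n * J)" by (simp add: A_def algebra_simps)
    also have "A 1 = 1 + exp (- 2 * (real n - 2) * J)" by (simp add: A_def algebra_simps)
    finally show ?thesis by (simp add: algebra_simps)
  qed
  then show ?thesis using fin cN c by blast
qed

end

theorem theorem6p3:
  fixes J :: real and M :: "'w measure" and X :: "'w \<Rightarrow> int ^ 'd::finite \<Rightarrow> int"
  defines "d \<equiv> CARD('d)"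
  assumes "d \<ge> 2" and "J > 0"
    and "prob_space M" and "X \<in> M \<rightarrow>\<^sub>M spins UNIV"
    and "ising_gibbs J (distr M (spins UNIV) X)"
    and "exp (2 * real d * J) / (exp (2 * real d * J) + exp (- (2 * real d * J)))
           \<le> 1 / (1 - r2 (2 * d))"
  shows "\<not> in_R M (\<lambda>\<omega> i. X \<omega> i = 1)"
proof
  assume R: "in_R M (\<lambda>\<omega> i. X \<omega> i = 1)"
  interpret ising J "distr M (spins UNIV) X"
    using assms by unfold_locales
  define n where "n = 2 * CARD('d)"
  have n: "n \<ge> 4" "n = 2 * d" using assms(2) by (simp_all add: n_def d_def)
  define x0 where "x0 = - 2 * real n * J"
  \<comment> \<open>The step is chosen with \<open>B / A = exp s\<close>, so that the two powers
    combine to \<open>A ^ k * (1 + exp (x0 + k * s))\<close>.\<close>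
  define A B s where "A = 1 + exp x0" and "B = 1 + exp (- 2 * (real n - 2) * J)" and "s = ln (B / A)"
  have "x0 < - 2 * (real n - 2) * J" using \<open>J > 0\<close> by (simp add: x0_def algebra_simps)
  then have AB: "0 < A" "A < B" by (simp_all add: A_def B_def add_pos_pos)
  then have s: "s > 0" by (simp add: s_def)
  obtain \<nu> where \<nu>: "sets \<nu> = sets nonempty_subsets" and
    avoid: "\<And>K. finite K \<Longrightarrow> measure M {\<omega> \<in> space M. \<forall>i\<in>K. \<not> X \<omega> i = 1} \<noteq> 0 \<Longrightarrow>
       emeasure \<nu> (hitting K) < \<infinity> \<and>
       measure M {\<omega> \<in> space M. \<forall>i\<in>K. \<not> X \<omega> i = 1} = exp (- measure \<nu> (hitting K))"
    using in_R_avoidance_prob[OF R] by blast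
  have hit: "emeasure \<nu> (hitting K) < \<infinity>"
    "measure \<nu> (hitting K) = - ln (measure (distr M (spins UNIV) X) (cyl K (\<lambda>_. -1)))" if K: "finite K" for K
  proof -
    have "cyl K (\<lambda>_. -1) \<in> sets (spins UNIV)" using cyl_sets[OF K, of "\<lambda>_. -1"] by simp
    then have "measure (distr M (spins UNIV) X) (cyl K (\<lambda>_. -1))
        = measure M (X -` cyl K (\<lambda>_. -1) \<inter> space M)"
      by (rule measure_distr[OF assms(5)])
    also have "X -` cyl K (\<lambda>_. -1) \<inter> space M = {\<omega> \<in> space M. \<forall>i\<in>K. \<not> X \<omega> i = 1}"
      using measurable_space[OF assms(5)] spin_range by (fastforce simp: cyl_def)
    finally have eq: "measure M {\<omega> \<in> space M. \<forall>i\<in>K. \<not> X \<omega> i = 1}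
        = measure (distr M (spins UNIV) X) (cyl K (\<lambda>_. -1))" ..
    have pos: "measure (distr M (spins UNIV) X) (cyl K (\<lambda>_. -1)) > 0"
      by (rule cyl_pos[OF K]) simp
    show "emeasure \<nu> (hitting K) < \<infinity>"
      "measure \<nu> (hitting K) = - ln (measure (distr M (spins UNIV) X) (cyl K (\<lambda>_. -1)))"
      using avoid[OF K] pos unfolding eq by auto
  qed
  obtain D N c where fin: "finite D" "finite N" and cN: "card N = n" and c: "c > 0"
    and star: "\<And>C. C \<subseteq> N \<Longrightarrow> measure (distr M (spins UNIV) X) (cyl (D \<union> C) (\<lambda>_. -1)) =
       c * (A ^ (n - card C) + exp x0 * B ^ (n - card C))"
    using star_prob unfolding A_def B_def x0_def n_def by blast
  have L: "measure \<nu> (hitting (D \<union> C)) = (- ln c - real n * ln A) + ln A * real (card C)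
      - softplus (x0 + (real (card N) - real (card C)) * s)" if C: "C \<subseteq> N" for C
  proof -
    define k where "k = n - card C"
    have finC: "finite C" "card C \<le> n" using C fin cN finite_subset card_mono by auto
    then have k: "real k = real n - real (card C)" by (simp add: k_def of_nat_diff)
    have "exp (real k * s) = (B / A) ^ k"
      using AB by (simp add: s_def exp_of_nat_mult)
    then have e: "A ^ k + exp x0 * B ^ k = A ^ k * (1 + exp (x0 + real k * s))"
      using AB by (simp add: exp_add power_divide distrib_left)
    have "measure \<nu> (hitting (D \<union> C)) = - ln (c * (A ^ k * (1 + exp (x0 + real k * s))))"
      using hit(2)[of "D \<union> C"] star[OF C] fin finC e by (simp add: k_def)
    also have "\<dots> = - ln c - real k * ln A - softplus (x0 + real k * s)"
      using c AB by (simp add: ln_mult ln_realpow softplus_def)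
    finally show ?thesis unfolding k cN by (simp add: algebra_simps)
  qed
  have nonneg: "fd s softplus m x0 \<ge> 0" if m: "m \<in> {2..n}" for m
  proof -
    obtain N' where N': "N' \<subseteq> N" "card N' = m" "finite N'"
      using obtain_subset_with_card_n[of m N] m cN by auto
    \<comment> \<open>Every site of \<open>N\<close> is either covered or avoided, so the difference
      is evaluated at \<open>x0\<close> itself.\<close>
    define C where "C = N - N'"
    have C: "N' \<union> C \<subseteq> N" "N' \<inter> C = {}" using N' by (auto simp: C_def)
    have "card C = n - m" using N' cN by (simp add: C_def card_Diff_subset)
    then have "real (card N) - real (card C) - real (card N') = 0"
      using cN N' m by (simp add: of_nat_diff)
    moreover have "N' \<noteq> {}" using N' m by auto
    ultimately have "fd s softplus m x0 = measure \<nu> {b \<in> space \<nu>. (\<forall>i\<in>N'. b i) \<and> (\<forall>i\<in>D \<union> C. \<not> b i)}"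
      using covering_measure_eq[OF \<nu> fin(2,1) _ L N'(3) _ C] hit(1) fin finite_subset N' m by simp
    then show ?thesis by simp
  qed
  define \<rho> where "\<rho> = - r2 n / (1 - r2 n)"
  have root: "poly (cumulant_poly (n - 1)) \<rho> = 0" and r2: "r2 n < 0"
    using r2_root[of n] n by (auto simp: \<rho>_def)
  have "\<rho> > 0" unfolding \<rho>_def using r2 by (intro divide_pos_pos) auto
  have \<rho>1: "1 - \<rho> = 1 / (1 - r2 n)" using r2 by (simp add: \<rho>_def field_simps)
  \<comment> \<open>Together with \<open>\<rho>1\<close> this turns the hypothesis on
    \<open>r2\<close> into \<open>\<rho> \<le> logistic x0\<close>.\<close>
  have "exp (2 * real d * J) / (exp (2 * real d * J) + exp (- (2 * real d * J))) = 1 - logistic x0"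
  proof -
    define E where "E = exp (2 * real d * J)"
    have E: "E > 0" by (simp add: E_def)
    have "exp x0 = 1 / (E * E)"
      by (simp add: E_def x0_def n exp_minus inverse_eq_divide flip: exp_add)
    moreover have EE: "E * E \<noteq> 0" "E * E + 1 \<noteq> 0" using E by (simp, smt (verit) mult_pos_pos)
    ultimately have "1 + exp x0 = (E * E + 1) / (E * E)" by (simp add: add_divide_distrib)
    moreover have "1 - logistic x0 = 1 / (1 + exp x0)" by (simp add: logistic_def diff_divide_eq_iff)
    ultimately have "1 - logistic x0 = E * E / (E * E + 1)" by simp
    moreover have "E + 1 / E = (E * E + 1) / E" using E by (simp add: add_divide_distrib)
    then have "E / (E + 1 / E) = E * E / (E * E + 1)" by simp
    ultimately show ?thesis by (simp add: E_def exp_minus inverse_eq_divide)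
  qed
  then have "\<rho> \<le> logistic x0" using assms(7) \<rho>1 n(2) by simp
  with s have "\<exists>m\<in>{2..n}. fd s softplus m x0 < 0"
    using n(1) root \<open>\<rho> > 0\<close> by (intro fd_softplus_exists_neg) auto
  then show False using nonneg by (meson not_less)
qed

end
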